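(* There is a functor $\Psi\colon\mathbf{Bi}\to\mathbf{Diffeol}$ that sends a Lie groupoid $G=(G_1\rightrightarrows G_0)$ to its orbit space $G_0/G_1$, sends a bibundle $P\colon G\to H$ with anchor maps $a_L\colon P\to G_0$ and $a_R\colon P\to H_0$ to a unique smooth map $\Psi_P\colon G_0/G_1\to H_0/H_1$ such that $$\Psi_P\circ\pi_G\circ a_L=\pi_H\circ a_R,$$ and sends a $2$-arrow in $\mathbf{Bi}$ to a trivial $2$-arrow in $\mathbf{Diffeol}$ (so isomorphic bibundles $P,Q\colon G\to H$ have $\Psi_P=\Psi_Q$).
   Context: **Lie groupoids.** All Lie groupoids $G=(G_1\rightrightarrows G_0)$ are finite dimensional, paracompact and Hausdorff, with source and target $s,t\colon G_1\to G_0$. The orbit of $x\in G_0$ is $\{t(g)\mid g\in G_1,\ s(g)=x\}$; the orbit space $G_0/G_1$ is the set of orbits, and $\pi_G\colon G_0\to G_0/G_1$ is the quotient map. **Diffeology.** A parametrisation of a set $X$ is a map of sets $p\colon U\to X$ with $U$ an open subset of some Euclidean space (of any dimension). A diffeology on $X$ is a family $\mathcal D$ of parametrisations (called plots) such that: (1) all constant parametrisations are in $\mathcal D$; (2) if $p\colon U\to X$ is a parametrisation and $U$ has an open cover $\{U_\alpha\}$ with every $p|_{U_\alpha}\in\mathcal D$, then $p\in\mathcal D$; (3) if $(p\colon U\to X)\in\mathcal D$ and $f\colon V\to U$ is a smooth map from an open subset $V$ of a Euclidean space, then $p\circ f\in\mathcal D$. A map between diffeological spaces is smooth if its composition with every plot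 is a plot. $\mathbf{Diffeol}$ is the category of diffeological spaces and smooth maps, regarded as a 2-category with only trivial (identity) 2-arrows. A manifold carries the standard diffeology, consisting of all smooth parametrisations. If $\sim$ is an equivalence relation on a diffeological space $X$ with quotient map $\pi$, the quotient diffeology on $X/\!\sim$ consists of all parametrisations $p\colon U\to X/\!\sim$ such that each $u\in U$ has an open neighbourhood $V$ on which $p|_V=\pi\circ q$ for some plot $q\colon V\to X$. Orbit spaces $G_0/G_1$ carry the quotient diffeology induced by the standard diffeology of $G_0$. **Bibundles and $\mathbf{Bi}$.** A (right principal) bibundle $P\colon G\to H$ is a manifold $P$ with smooth anchor maps $a_L\colon P\to G_0$, $a_R\colon P\to H_0$, a smooth left action of $G$ along $a_L$ ($g\cdot p$ is defined when $s(g)=a_L(p)$, and $a_L(g\cdot p)=t(g)$) and a smooth right action of $H$ along $a_R$ ($p\cdot h$ is defined when $a_R(p)=t(h)$, and $a_R(p\cdot h)=s(h)$), such that the actions commute, $a_L$ is $H$-invariant, $a_R$ is $G$-invariant, and $a_L\colon P\to G_0$ is a principal $H$-bundle (i.e. $a_L$ is a surjective submersion and $(p,h)\mapsto(p,p\cdot h)$ is a diffeomorphism $P\times_{H_0}H_1\to P\times_{G_0}P$). The composition of $P\colon G\to H$ and $Q\colon H\to K$ is the quotient $Q\circ P=(P\times_{H_0}Q)/H$ by the diagonal $H$-action. $\mathbf{Bi}$ is the bicategory of Lie groupoids, bibundles as arrows, and isomorphisms of bibundles (biequivariant diffeomorphisms) as 2-arrows; the identity arrow of $G$ is $G_1$ with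 left and right multiplication. *)

theory Defs
  imports "HOL-Analysis.Analysis"
begin

section \<open>Smooth maps between open subsets of Euclidean spaces\<close>

text \<open>
  All dimensions occur in one statement, so \<open>\<real>\<^sup>n\<close> is the library space \<^const>\<open>Euclidean_space\<close> \<open>n\<close>,
  whose points are the sequences vanishing from index \<open>n\<close> on.  \<open>C_on k n U f\<close> says that the real
  function \<open>f\<close> is \<open>C\<^sup>k\<close> on the open set \<open>U\<close> of \<open>\<real>\<^sup>n\<close>; only the values of \<open>f\<close> on \<open>U\<close> matter.
\<close>

primrec C_on :: "nat \<Rightarrow> nat \<Rightarrow> (nat \<Rightarrow> real) set \<Rightarrow> ((nat \<Rightarrow> real) \<Rightarrow> real) \<Rightarrow> bool" where
  "C_on 0 n U f \<longleftrightarrow> continuous_map (subtopology (Euclidean_space n) U) euclideanreal f"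
| "C_on (Suc k) n U f \<longleftrightarrow>
     continuous_map (subtopology (Euclidean_space n) U) euclideanreal f \<and>
     (\<forall>i<n. \<exists>g. C_on k n U g \<and>
        (\<forall>x\<in>U. ((\<lambda>t. f (x(i := t))) has_real_derivative g x) (at (x i))))"

definition smooth_euclid ::
    "nat \<Rightarrow> (nat \<Rightarrow> real) set \<Rightarrow> nat \<Rightarrow> ((nat \<Rightarrow> real) \<Rightarrow> nat \<Rightarrow> real) \<Rightarrow> bool" where
  "smooth_euclid n U m f \<longleftrightarrow>
     f ` U \<subseteq> topspace (Euclidean_space m) \<and> (\<forall>j<m. \<forall>k. C_on k n U (\<lambda>x. f x j))"


section \<open>Manifolds\<close>

text \<open>
  A chart \<open>(n, V, \<phi>)\<close> is a map \<open>\<phi>\<close> from \<open>V\<close> to \<open>\<real>\<^sup>n\<close>.  Atlases need not be maximal.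
\<close>

record 'a manifold =
  mtop :: "'a topology"
  atlas :: "(nat \<times> 'a set \<times> ('a \<Rightarrow> nat \<Rightarrow> real)) set"

abbreviation pts :: "'a manifold \<Rightarrow> 'a set" where
  "pts M \<equiv> topspace (mtop M)"

definition paracompact_space :: "'a topology \<Rightarrow> bool" where
  "paracompact_space X \<longleftrightarrow>
     (\<forall>\<U>. (\<forall>U\<in>\<U>. openin X U) \<and> \<Union>\<U> = topspace X \<longrightarrow>
        (\<exists>\<V>. (\<forall>V\<in>\<V>. openin X V \<and> (\<exists>U\<in>\<U>. V \<subseteq> U)) \<and> \<Union>\<V> = topspace X \<and> locally_finite_in X \<V>))"

definition local_rep ::
    "'a set \<Rightarrow> ('a \<Rightarrow> nat \<Rightarrow> real) \<Rightarrow> ('a \<Rightarrow> 'b) \<Rightarrow> ('b \<Rightarrow> nat \<Rightarrow> real) \<Rightarrow> (nat \<Rightarrow> real) \<Rightarrow> nat \<Rightarrow> real" where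
  "local_rep V \<phi> f \<psi> = \<psi> \<circ> f \<circ> inv_into V \<phi>"

text \<open>
  The dimension may differ between components but must be bounded; manifolds of pure dimension
  are a special case.
\<close>

definition smooth_manifold :: "'a manifold \<Rightarrow> bool" where
  "smooth_manifold M \<longleftrightarrow>
     Hausdorff_space (mtop M) \<and> paracompact_space (mtop M) \<and>
     (\<Union>(n, V, \<phi>)\<in>atlas M. V) = pts M \<and>
     (\<exists>N. \<forall>(n, V, \<phi>)\<in>atlas M. V \<noteq> {} \<longrightarrow> n \<le> N) \<and>
     (\<forall>(n, V, \<phi>)\<in>atlas M.
        openin (mtop M) V \<and> openin (Euclidean_space n) (\<phi> ` V) \<and>
        homeomorphic_map (subtopology (mtop M) V) (subtopology (Euclidean_space n) (\<phi> ` V)) \<phi>) \<and>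
     (\<forall>(n, V, \<phi>)\<in>atlas M. \<forall>(m, W, \<psi>)\<in>atlas M.
        smooth_euclid n (\<phi> ` (V \<inter> W)) m (local_rep V \<phi> id \<psi>))"

definition smooth_map :: "'a manifold \<Rightarrow> 'b manifold \<Rightarrow> ('a \<Rightarrow> 'b) \<Rightarrow> bool" where
  "smooth_map M N f \<longleftrightarrow>
     continuous_map (mtop M) (mtop N) f \<and>
     (\<forall>(n, V, \<phi>)\<in>atlas M. \<forall>(m, W, \<psi>)\<in>atlas N.
        smooth_euclid n (\<phi> ` {x\<in>V. f x \<in> W}) m (local_rep V \<phi> f \<psi>))"

definition diffeomorphism :: "'a manifold \<Rightarrow> 'b manifold \<Rightarrow> ('a \<Rightarrow> 'b) \<Rightarrow> bool" where
  "diffeomorphism M N f \<longleftrightarrow>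
     smooth_map M N f \<and> bij_betw f (pts M) (pts N) \<and> smooth_map N M (inv_into (pts M) f)"

text \<open>A smooth map whose differential, i.e. its Jacobian in charts, is onto at every point.\<close>

definition submersion :: "'a manifold \<Rightarrow> 'b manifold \<Rightarrow> ('a \<Rightarrow> 'b) \<Rightarrow> bool" where
  "submersion M N f \<longleftrightarrow>
     smooth_map M N f \<and>
     (\<forall>(n, V, \<phi>)\<in>atlas M. \<forall>(m, W, \<psi>)\<in>atlas N. \<forall>x\<in>V. f x \<in> W \<longrightarrow>
        (\<forall>w. \<exists>v. \<forall>j<m.
           (\<Sum>i<n. deriv (\<lambda>t. local_rep V \<phi> f \<psi> ((\<phi> x)(i := t)) j) (\<phi> x i) * v i) = w j))"

definition euclid :: "nat \<Rightarrow> (nat \<Rightarrow> real) set \<Rightarrow> (nat \<Rightarrow> real) manifold" where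
  "euclid n U = \<lparr>mtop = subtopology (Euclidean_space n) U, atlas = {(n, U, id)}\<rparr>"

definition open_submanifold :: "'a manifold \<Rightarrow> 'a set \<Rightarrow> 'a manifold" where
  "open_submanifold M S =
     \<lparr>mtop = subtopology (mtop M) S, atlas = {(n, V \<inter> S, \<phi>) | n V \<phi>. (n, V, \<phi>) \<in> atlas M}\<rparr>"

definition prod_manifold :: "'a manifold \<Rightarrow> 'b manifold \<Rightarrow> ('a \<times> 'b) manifold" where
  "prod_manifold M N =
     \<lparr>mtop = prod_topology (mtop M) (mtop N),
      atlas = {(n + m, V \<times> W, \<lambda>(x, y) i. if i < n then \<phi> x i else \<psi> y (i - n)) | n V \<phi> m W \<psi>.
                 (n, V, \<phi>) \<in> atlas M \<and> (m, W, \<psi>) \<in> atlas N}\<rparr>"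

text \<open>
  The structure on an embedded submanifold \<open>S\<close> of \<open>M\<close>: the subspace topology, and as charts all
  bijections \<open>\<phi>\<close> from a relatively open \<open>V \<subseteq> S\<close> to an open set of \<open>\<real>\<^sup>n\<close> such that \<open>\<phi>\<^sup>-\<^sup>1\<close> is smooth
  into \<open>M\<close> and \<open>\<phi>\<close> locally extends to a smooth map on an open subset of \<open>M\<close>.
  If \<open>S\<close> is embedded, this is its maximal atlas.
\<close>

definition submanifold :: "'a manifold \<Rightarrow> 'a set \<Rightarrow> 'a manifold" where
  "submanifold M S =
     \<lparr>mtop = subtopology (mtop M) S,
      atlas = {(n, V, \<phi>).
        V \<noteq> {} \<and> openin (subtopology (mtop M) S) V \<and>
        inj_on \<phi> V \<and> openin (Euclidean_space n) (\<phi> ` V) \<and>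
        smooth_map (euclid n (\<phi> ` V)) M (inv_into V \<phi>) \<and>
        (\<forall>x\<in>V. \<exists>W g. openin (mtop M) W \<and> x \<in> W \<and>
           smooth_map (open_submanifold M W) (euclid n (topspace (Euclidean_space n))) g \<and>
           (\<forall>y\<in>W \<inter> V. g y = \<phi> y))}\<rparr>"

definition fibre_product ::
    "'a manifold \<Rightarrow> 'b manifold \<Rightarrow> ('a \<Rightarrow> 'c) \<Rightarrow> ('b \<Rightarrow> 'c) \<Rightarrow> ('a \<times> 'b) manifold" where
  "fibre_product M N f g =
     submanifold (prod_manifold M N) {(x, y). x \<in> pts M \<and> y \<in> pts N \<and> f x = g y}"

text \<open>
  The structure on the image of \<open>q\<close> that makes \<open>q\<close> a submersion: the quotient topology, and as charts
  all bijections \<open>\<phi>\<close> from an open \<open>V\<close> to an open set of \<open>\<real>\<^sup>n\<close> such that \<open>\<phi> \<circ> q\<close> is a submersion.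
  If a manifold structure making \<open>q\<close> a submersion exists, it is unique and this is its maximal atlas.
\<close>

definition quotient_manifold :: "'a manifold \<Rightarrow> ('a \<Rightarrow> 'b) \<Rightarrow> 'b manifold" where
  "quotient_manifold M q =
     (let X = topology (\<lambda>U. U \<subseteq> q ` pts M \<and> openin (mtop M) {x\<in>pts M. q x \<in> U}) in
     \<lparr>mtop = X,
      atlas = {(n, V, \<phi>).
        V \<noteq> {} \<and> openin X V \<and> inj_on \<phi> V \<and> openin (Euclidean_space n) (\<phi> ` V) \<and>
        submersion (open_submanifold M {x\<in>pts M. q x \<in> V}) (euclid n (\<phi> ` V)) (\<phi> \<circ> q)}\<rparr>)"


section \<open>Diffeological spaces\<close>

text \<open>
  A parametrisation \<open>(n, U, p)\<close> is a map \<open>p\<close> on an open set \<open>U\<close> of \<open>\<real>\<^sup>n\<close>.  It is represented by a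
  function that is \<^const>\<open>undefined\<close> outside \<open>U\<close>, so that equality is equality of maps on \<open>U\<close>;
  morphisms of diffeological spaces are treated in the same way.
\<close>

type_synonym 'x parametrisation = "nat \<times> (nat \<Rightarrow> real) set \<times> ((nat \<Rightarrow> real) \<Rightarrow> 'x)"

record 'x diffeo_space =
  points :: "'x set"
  plots :: "'x parametrisation set"

definition parametrisations :: "'x set \<Rightarrow> 'x parametrisation set" where
  "parametrisations X = {(n, U, p). openin (Euclidean_space n) U \<and> p \<in> U \<rightarrow>\<^sub>E X}"

definition diffeological_space :: "'x diffeo_space \<Rightarrow> bool" where
  "diffeological_space X \<longleftrightarrow>
     plots X \<subseteq> parametrisations (points X) \<and>
     (\<forall>n U. \<forall>x\<in>points X. openin (Euclidean_space n) U \<longrightarrow> (n, U, \<lambda>u\<in>U. x) \<in> plots X) \<and>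
     (\<forall>(n, U, p)\<in>parametrisations (points X).
        (\<exists>\<U>. \<Union>\<U> = U \<and> (\<forall>V\<in>\<U>. openin (Euclidean_space n) V \<and> (n, V, restrict p V) \<in> plots X)) \<longrightarrow>
        (n, U, p) \<in> plots X) \<and>
     (\<forall>(n, U, p)\<in>plots X. \<forall>m V f.
        openin (Euclidean_space m) V \<and> smooth_euclid m V n f \<and> f ` V \<subseteq> U \<longrightarrow>
        (m, V, compose V p f) \<in> plots X)"

definition diffeol_maps :: "'x diffeo_space \<Rightarrow> 'y diffeo_space \<Rightarrow> ('x \<Rightarrow> 'y) set" where
  "diffeol_maps X Y =
     {f. f \<in> points X \<rightarrow>\<^sub>E points Y \<and> (\<forall>(n, U, p)\<in>plots X. (n, U, compose U f p) \<in> plots Y)}"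

definition diffeol_id :: "'x diffeo_space \<Rightarrow> 'x \<Rightarrow> 'x" where
  "diffeol_id X = (\<lambda>x\<in>points X. x)"

definition diffeol_comp :: "'x diffeo_space \<Rightarrow> ('y \<Rightarrow> 'z) \<Rightarrow> ('x \<Rightarrow> 'y) \<Rightarrow> 'x \<Rightarrow> 'z" where
  "diffeol_comp X g f = compose (points X) g f"

definition manifold_diffeology :: "'a manifold \<Rightarrow> 'a diffeo_space" where
  "manifold_diffeology M =
     \<lparr>points = pts M,
      plots = {(n, U, p)\<in>parametrisations (pts M). smooth_map (euclid n U) M p}\<rparr>"

definition quotient_diffeology :: "'x diffeo_space \<Rightarrow> ('x \<times> 'x) set \<Rightarrow> 'x set diffeo_space" where
  "quotient_diffeology X R =
     \<lparr>points = points X // R,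
      plots = {(n, U, p)\<in>parametrisations (points X // R).
        \<forall>u\<in>U. \<exists>V q. openin (Euclidean_space n) V \<and> u \<in> V \<and> V \<subseteq> U \<and>
          (n, V, q) \<in> plots X \<and> (\<forall>v\<in>V. p v = R `` {q v})}\<rparr>"


section \<open>Lie groupoids\<close>

text \<open>
  \<open>mult G g h\<close> is the product \<open>gh\<close>, defined when \<open>src G g = tgt G h\<close>.
\<close>

record ('o, 'g) groupoid =
  Obj :: "'o manifold"
  Arr :: "'g manifold"
  src :: "'g \<Rightarrow> 'o"
  tgt :: "'g \<Rightarrow> 'o"
  mult :: "'g \<Rightarrow> 'g \<Rightarrow> 'g"
  unit :: "'o \<Rightarrow> 'g"
  ginv :: "'g \<Rightarrow> 'g"

definition lie_groupoid :: "('o, 'g) groupoid \<Rightarrow> bool" where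
  "lie_groupoid G \<longleftrightarrow>
     smooth_manifold (Obj G) \<and> smooth_manifold (Arr G) \<and>
     submersion (Arr G) (Obj G) (src G) \<and> submersion (Arr G) (Obj G) (tgt G) \<and>
     smooth_map (Obj G) (Arr G) (unit G) \<and> smooth_map (Arr G) (Arr G) (ginv G) \<and>
     smooth_map (fibre_product (Arr G) (Arr G) (src G) (tgt G)) (Arr G) (\<lambda>(g, h). mult G g h) \<and>
     (\<forall>g\<in>pts (Arr G). \<forall>h\<in>pts (Arr G). src G g = tgt G h \<longrightarrow>
        src G (mult G g h) = src G h \<and> tgt G (mult G g h) = tgt G g) \<and>
     (\<forall>g\<in>pts (Arr G). \<forall>h\<in>pts (Arr G). \<forall>k\<in>pts (Arr G).
        src G g = tgt G h \<and> src G h = tgt G k \<longrightarrow>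
        mult G (mult G g h) k = mult G g (mult G h k)) \<and>
     (\<forall>x\<in>pts (Obj G). src G (unit G x) = x \<and> tgt G (unit G x) = x) \<and>
     (\<forall>g\<in>pts (Arr G). mult G g (unit G (src G g)) = g \<and> mult G (unit G (tgt G g)) g = g) \<and>
     (\<forall>g\<in>pts (Arr G). src G (ginv G g) = tgt G g \<and> tgt G (ginv G g) = src G g \<and>
        mult G g (ginv G g) = unit G (tgt G g) \<and> mult G (ginv G g) g = unit G (src G g))"

definition orbit_rel :: "('o, 'g) groupoid \<Rightarrow> ('o \<times> 'o) set" where
  "orbit_rel G = {(x, y). \<exists>g\<in>pts (Arr G). src G g = x \<and> tgt G g = y}"

definition orbit_proj :: "('o, 'g) groupoid \<Rightarrow> 'o \<Rightarrow> 'o set" where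
  "orbit_proj G x = orbit_rel G `` {x}"

definition orbit_space :: "('o, 'g) groupoid \<Rightarrow> 'o set diffeo_space" where
  "orbit_space G = quotient_diffeology (manifold_diffeology (Obj G)) (orbit_rel G)"


section \<open>Bibundles\<close>

text \<open>\<open>lact P g p\<close> is \<open>g \<cdot> p\<close> and \<open>ract P p h\<close> is \<open>p \<cdot> h\<close>.\<close>

record ('p, 'x, 'g, 'y, 'h) bibundle =
  Tot :: "'p manifold"
  aL :: "'p \<Rightarrow> 'x"
  aR :: "'p \<Rightarrow> 'y"
  lact :: "'g \<Rightarrow> 'p \<Rightarrow> 'p"
  ract :: "'p \<Rightarrow> 'h \<Rightarrow> 'p"

definition bibundle ::
    "('x, 'g) groupoid \<Rightarrow> ('y, 'h) groupoid \<Rightarrow> ('p, 'x, 'g, 'y, 'h) bibundle \<Rightarrow> bool" where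
  "bibundle G H P \<longleftrightarrow>
     smooth_manifold (Tot P) \<and>
     smooth_map (Tot P) (Obj G) (aL P) \<and> smooth_map (Tot P) (Obj H) (aR P) \<and>
     smooth_map (fibre_product (Arr G) (Tot P) (src G) (aL P)) (Tot P) (\<lambda>(g, p). lact P g p) \<and>
     (\<forall>g\<in>pts (Arr G). \<forall>p\<in>pts (Tot P). src G g = aL P p \<longrightarrow>
        aL P (lact P g p) = tgt G g \<and> aR P (lact P g p) = aR P p) \<and>
     (\<forall>p\<in>pts (Tot P). lact P (unit G (aL P p)) p = p) \<and>
     (\<forall>g\<in>pts (Arr G). \<forall>g'\<in>pts (Arr G). \<forall>p\<in>pts (Tot P).
        src G g = tgt G g' \<and> src G g' = aL P p \<longrightarrow>
        lact P (mult G g g') p = lact P g (lact P g' p)) \<and>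
     smooth_map (fibre_product (Tot P) (Arr H) (aR P) (tgt H)) (Tot P) (\<lambda>(p, h). ract P p h) \<and>
     (\<forall>p\<in>pts (Tot P). \<forall>h\<in>pts (Arr H). aR P p = tgt H h \<longrightarrow>
        aR P (ract P p h) = src H h \<and> aL P (ract P p h) = aL P p) \<and>
     (\<forall>p\<in>pts (Tot P). ract P p (unit H (aR P p)) = p) \<and>
     (\<forall>p\<in>pts (Tot P). \<forall>h\<in>pts (Arr H). \<forall>h'\<in>pts (Arr H).
        aR P p = tgt H h \<and> src H h = tgt H h' \<longrightarrow>
        ract P p (mult H h h') = ract P (ract P p h) h') \<and>
     (\<forall>g\<in>pts (Arr G). \<forall>p\<in>pts (Tot P). \<forall>h\<in>pts (Arr H).
        src G g = aL P p \<and> aR P p = tgt H h \<longrightarrow>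
        ract P (lact P g p) h = lact P g (ract P p h)) \<and>
     submersion (Tot P) (Obj G) (aL P) \<and> aL P ` pts (Tot P) = pts (Obj G) \<and>
     diffeomorphism (fibre_product (Tot P) (Arr H) (aR P) (tgt H))
       (fibre_product (Tot P) (Tot P) (aL P) (aL P)) (\<lambda>(p, h). (p, ract P p h))"

text \<open>The 2-arrows from \<open>P\<close> to \<open>P'\<close>: biequivariant diffeomorphisms, compatible with the anchors.\<close>

definition bibundle_iso ::
    "('x, 'g) groupoid \<Rightarrow> ('y, 'h) groupoid \<Rightarrow> ('p, 'x, 'g, 'y, 'h) bibundle \<Rightarrow>
     ('q, 'x, 'g, 'y, 'h) bibundle \<Rightarrow> ('p \<Rightarrow> 'q) \<Rightarrow> bool" where
  "bibundle_iso G H P P' \<alpha> \<longleftrightarrow>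
     diffeomorphism (Tot P) (Tot P') \<alpha> \<and>
     (\<forall>p\<in>pts (Tot P). aL P' (\<alpha> p) = aL P p \<and> aR P' (\<alpha> p) = aR P p) \<and>
     (\<forall>g\<in>pts (Arr G). \<forall>p\<in>pts (Tot P). src G g = aL P p \<longrightarrow> \<alpha> (lact P g p) = lact P' g (\<alpha> p)) \<and>
     (\<forall>p\<in>pts (Tot P). \<forall>h\<in>pts (Arr H). aR P p = tgt H h \<longrightarrow> \<alpha> (ract P p h) = ract P' (\<alpha> p) h)"

definition bi_id :: "('x, 'g) groupoid \<Rightarrow> ('g, 'x, 'g, 'x, 'g) bibundle" where
  "bi_id G = \<lparr>Tot = Arr G, aL = tgt G, aR = src G, lact = mult G, ract = mult G\<rparr>"

text \<open>
  The composite \<open>Q \<circ> P\<close> is the quotient of the fibre product of \<open>P\<close> and \<open>Q\<close> over \<open>H\<^sub>0\<close> by the diagonal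
  action \<open>(p, q) \<cdot> h = (p \<cdot> h, h\<^sup>-\<^sup>1 \<cdot> q)\<close>.  Its points are the orbits \<open>c\<close>, so \<open>g \<cdot> c\<close> and \<open>c \<cdot> k\<close> are the
  images of \<open>c\<close> under the actions on the components, and the anchors are constant on \<open>c\<close>.
\<close>

definition diag_orbit ::
    "('y, 'h) groupoid \<Rightarrow> ('p, 'x, 'g, 'y, 'h) bibundle \<Rightarrow> ('q, 'y, 'h, 'z, 'k) bibundle \<Rightarrow>
     'p \<times> 'q \<Rightarrow> ('p \<times> 'q) set" where
  "diag_orbit H P Q = (\<lambda>(p, q).
     {(ract P p h, lact Q (ginv H h) q) | h. h \<in> pts (Arr H) \<and> tgt H h = aR P p})"

definition bi_comp ::
    "('y, 'h) groupoid \<Rightarrow> ('q, 'y, 'h, 'z, 'k) bibundle \<Rightarrow> ('p, 'x, 'g, 'y, 'h) bibundle \<Rightarrow>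
     (('p \<times> 'q) set, 'x, 'g, 'z, 'k) bibundle" where
  "bi_comp H Q P =
     \<lparr>Tot = quotient_manifold (fibre_product (Tot P) (Tot Q) (aR P) (aL Q)) (diag_orbit H P Q),
      aL = (\<lambda>c. the_elem ((\<lambda>(p, q). aL P p) ` c)),
      aR = (\<lambda>c. the_elem ((\<lambda>(p, q). aR Q q) ` c)),
      lact = (\<lambda>g c. (\<lambda>(p, q). (lact P g p, q)) ` c),
      ract = (\<lambda>c k. (\<lambda>(p, q). (p, ract Q q k)) ` c)\<rparr>"


section \<open>The functor on objects and arrows\<close>

text \<open>
  Diffeological spaces have only identity 2-arrows.  Hence a functor into them preserves identities
  and composites strictly, its coherence conditions hold automatically, and its action on a 2-arrow
  from \<open>P\<close> to \<open>P'\<close> amounts to equality of the images of \<open>P\<close> and \<open>P'\<close>.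
\<close>

definition Psi_obj :: "('o, 'g) groupoid \<Rightarrow> 'o set diffeo_space" where
  "Psi_obj G = orbit_space G"

definition Psi_arr ::
    "('x, 'g) groupoid \<Rightarrow> ('y, 'h) groupoid \<Rightarrow> ('p, 'x, 'g, 'y, 'h) bibundle \<Rightarrow>
     'x set \<Rightarrow> 'y set" where
  "Psi_arr G H P =
     (THE f. f \<in> diffeol_maps (Psi_obj G) (Psi_obj H) \<and>
        (\<forall>p\<in>pts (Tot P). f (orbit_proj G (aL P p)) = orbit_proj H (aR P p)))"

end

theory Submission
  imports Defs
begin

text \<open>
  Since \<open>a\<^sub>L\<close> is onto, the equation determines \<open>\<Psi>\<^sub>P\<close>, and functoriality and invariance under 2-arrows
  follow from this uniqueness.  \<open>\<Psi>\<^sub>P\<close> is well defined because \<open>H\<close> acts transitively on the fibres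
  of \<open>a\<^sub>L\<close>.  It is smooth because plots of \<open>G\<^sub>0\<close> lift locally along the submersion \<open>a\<^sub>L\<close>.

  Local sections of a submersion are obtained without the inverse function theorem: one solves
  for one coordinate at a time by the intermediate value theorem, and smoothness of the solution
  is bootstrapped from the formula for its partial derivatives.
\<close>

section \<open>Calculus of \<open>C\<^sup>k\<close> functions\<close>

text \<open>The dimension is a variable and the points of \<open>\<real>\<^sup>n\<close> are
  sequences in the product topology, so derivatives are taken one coordinate at a time.
  Caratheodory's form takes the place of a total derivative: a difference of values of
  \<open>f\<close> is a sum of coordinate differences with coefficients continuous at the base
  point. It yields the chain rule. It also yields the partial derivatives of an implicitly defined
  function of which only continuity is known, where the chain rule would be circular. Solving for a
  single coordinate keeps the analysis one-dimensional: strict monotonicity along a line replaces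
  the inversion of a matrix, and surjectivity of the Jacobian tells which coordinate is still free.

  For functoriality, the composite \<open>bi_comp\<close> enters through its points and anchors,
  since the uniqueness principle \<open>Psi_arr_eqI\<close> asks of the bundle that its left anchor
  be onto. Morphisms are \<open>undefined\<close> off their domain, so uniqueness is equality of
  functions and the description in \<open>Psi_arr\<close> denotes.\<close>

abbreviation Rn :: "nat \<Rightarrow> (nat \<Rightarrow> real) set" where
  "Rn n \<equiv> topspace (Euclidean_space n)"

abbreviation openRn :: "nat \<Rightarrow> (nat \<Rightarrow> real) set \<Rightarrow> bool" where
  "openRn n U \<equiv> openin (Euclidean_space n) U"

text \<open>Written with \<open>deriv\<close> so that it is literally an entry of the Jacobian in
  \<open>submersion\<close>, and so that the existential witnesses in \<open>C_on\<close> get a name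
  independent of the domain.\<close>

definition pd :: "nat \<Rightarrow> ((nat \<Rightarrow> real) \<Rightarrow> real) \<Rightarrow> (nat \<Rightarrow> real) \<Rightarrow> real" where
  "pd i f x = deriv (\<lambda>t. f (x(i := t))) (x i)"

text \<open>Bridge from the abstract topology in the definitions to the type class topology on
  sequences, where \<open>open\<close>, \<open>continuous_on\<close> and filters are
  available.\<close>

lemma Euclidean_space_top_of_set: "Euclidean_space n = top_of_set (Rn n)"
  unfolding topspace_Euclidean_space
  by (simp add: Euclidean_space_def euclidean_product_topology)

lemma openRn_iff: "openRn n U \<longleftrightarrow> (\<exists>T. open T \<and> U = Rn n \<inter> T)"
  by (subst Euclidean_space_top_of_set) (auto simp: openin_open)

lemma openRn_subset: "openRn n U \<Longrightarrow> U \<subseteq> Rn n"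
  by (rule openin_subset)

lemma continuous_map_Rn_iff:
  assumes "U \<subseteq> Rn n"
  shows "continuous_map (subtopology (Euclidean_space n) U) euclideanreal f \<longleftrightarrow> continuous_on U f"
proof -
  have "subtopology (Euclidean_space n) U = top_of_set U"
    using assms by (subst Euclidean_space_top_of_set) (simp add: subtopology_subtopology inf.absorb2)
  then show ?thesis by simp
qed

lemma continuous_on_fun_upd [continuous_intros]:
  fixes g :: "'b::topological_space \<Rightarrow> 'i \<Rightarrow> 'c::topological_space"
  assumes "continuous_on S g" "continuous_on S h"
  shows "continuous_on S (\<lambda>x. (g x)(i := h x))"
proof (rule continuous_on_coordinatewise_then_product)
  fix j
  show "continuous_on S (\<lambda>x. ((g x)(i := h x)) j)"
    using assms continuous_on_product_then_coordinatewise[OF assms(1), of j] by (cases "j = i") auto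
qed

lemma continuous_on_coord [continuous_intros]: "continuous_on S (\<lambda>x. x i)"
  by (rule continuous_on_subset[OF continuous_on_product_coordinates]) simp

lemma fun_upd_Rn: "x \<in> Rn n \<Longrightarrow> i < n \<Longrightarrow> x(i := t) \<in> Rn n"
  by (auto simp: topspace_Euclidean_space)

lemma openRn_fun_upd:
  assumes "openRn n U" "x \<in> U" "i < n"
  shows "open {t. x(i := t) \<in> U}"
proof -
  obtain T where T: "open T" "U = Rn n \<inter> T" using assms(1) openRn_iff by blast
  have "{t. x(i := t) \<in> U} = (\<lambda>t. x(i := t)) -` T"
    using T assms fun_upd_Rn by auto
  moreover have "open ((\<lambda>t. x(i := t)) -` T)"
    by (rule open_vimage[OF T(1)]) (intro continuous_intros)
  ultimately show ?thesis by simp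
qed

lemma eventually_fun_upd:
  assumes "openRn n U" "x \<in> U" "i < n"
  shows "\<forall>\<^sub>F t in nhds (x i). x(i := t) \<in> U"
  using openRn_fun_upd[OF assms] assms(2) eventually_nhds_in_open by fastforce

lemma C_on_continuous: "C_on k n U f \<Longrightarrow> U \<subseteq> Rn n \<Longrightarrow> continuous_on U f"
  by (cases k) (simp_all add: continuous_map_Rn_iff)

text \<open>Along a coordinate line through a point of the open set \<open>U\<close>, nearby points
  stay in \<open>U\<close>, so \<open>f\<close> and \<open>g\<close> agree near the point and the
  derivative witness of one serves the other. The witness itself is unchanged, hence a case
  distinction on \<open>k\<close> suffices.\<close>

lemma C_on_cong:
  assumes "openRn n U" "\<And>x. x \<in> U \<Longrightarrow> f x = g x"
  shows "C_on k n U f \<longleftrightarrow> C_on k n U g"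
proof -
  have *: "C_on k n U g" if "\<And>x. x \<in> U \<Longrightarrow> f x = g x" "C_on k n U f" for f g
  proof (cases k)
    case 0
    have "continuous_on U g \<longleftrightarrow> continuous_on U f"
      by (rule continuous_on_cong) (use that in auto)
    then show ?thesis using 0 that openRn_subset[OF assms(1)] by (simp add: continuous_map_Rn_iff)
  next
    case (Suc k')
    have "continuous_on U g \<longleftrightarrow> continuous_on U f"
      by (rule continuous_on_cong) (use that in auto)
    moreover have "\<exists>d. C_on k' n U d \<and>
        (\<forall>x\<in>U. ((\<lambda>t. g (x(i := t))) has_real_derivative d x) (at (x i)))" if i: "i < n" for i
    proof -
      obtain d where d: "C_on k' n U d"
        "\<And>x. x\<in>U \<Longrightarrow> ((\<lambda>t. f (x(i := t))) has_real_derivative d x) (at (x i))"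
        using \<open>C_on k n U f\<close> i unfolding Suc by auto
      have "((\<lambda>t. g (x(i := t))) has_real_derivative d x) (at (x i))" if x: "x \<in> U" for x
      proof (rule iffD1[OF DERIV_cong_ev d(2)[OF x]])
        show "\<forall>\<^sub>F t in nhds (x i). f (x(i := t)) = g (x(i := t))"
          using eventually_fun_upd[OF assms(1) x i] by eventually_elim (use \<open>\<And>x. x \<in> U \<Longrightarrow> f x = g x\<close> in auto)
      qed auto
      then show ?thesis using d by blast
    qed
    ultimately show ?thesis using Suc that openRn_subset[OF assms(1)] by (auto simp: continuous_map_Rn_iff)
  qed
  show ?thesis using *[of f g] *[of g f] assms(2) by auto
qed

lemma C_on_SucI:
  assumes "openRn n U" "continuous_on U f"
    "\<And>i. i < n \<Longrightarrow> C_on k n U (d i)"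
    "\<And>i x. i < n \<Longrightarrow> x \<in> U \<Longrightarrow> ((\<lambda>t. f (x(i := t))) has_real_derivative d i x) (at (x i))"
  shows "C_on (Suc k) n U f"
  using assms openRn_subset[OF assms(1)] by (auto simp: continuous_map_Rn_iff)

text \<open>Uniqueness of derivatives identifies any witness in \<open>C_on\<close> with
  \<open>pd i f\<close> on \<open>U\<close>.\<close>

lemma C_on_SucD:
  assumes "openRn n U" "C_on (Suc k) n U f" "i < n"
  shows "C_on k n U (pd i f)"
    and "x \<in> U \<Longrightarrow> ((\<lambda>t. f (x(i := t))) has_real_derivative pd i f x) (at (x i))"
proof -
  obtain d where d: "C_on k n U d"
    "\<And>x. x\<in>U \<Longrightarrow> ((\<lambda>t. f (x(i := t))) has_real_derivative d x) (at (x i))"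
    using assms(2,3) by auto
  have e: "pd i f x = d x" if "x \<in> U" for x
    unfolding pd_def by (rule DERIV_imp_deriv[OF d(2)[OF that]])
  show "C_on k n U (pd i f)" using C_on_cong[OF assms(1), of "pd i f" d] e d(1) by blast
  show "x \<in> U \<Longrightarrow> ((\<lambda>t. f (x(i := t))) has_real_derivative pd i f x) (at (x i))"
    using d(2) e by simp
qed

lemma C_on_lower: "C_on (Suc k) n U f \<Longrightarrow> C_on k n U f"
proof (induction k arbitrary: f)
  case (Suc k)
  from Suc.prems show ?case
    unfolding C_on.simps(2)[of "Suc k"] C_on.simps(2)[of "k" n U f] using Suc.IH by blast
qed auto

text \<open>The derivatives in \<open>C_on\<close> are two-sided derivatives of the total function,
  not relative to \<open>U\<close>, so the same witnesses work on any subset, open or not.\<close>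

lemma C_on_subset: "C_on k n U f \<Longrightarrow> V \<subseteq> U \<Longrightarrow> C_on k n V f"
proof (induction k arbitrary: f)
  case 0
  then show ?case by (auto intro: continuous_map_from_subtopology_mono)
next
  case (Suc k)
  have "continuous_map (subtopology (Euclidean_space n) V) euclideanreal f"
    using Suc.prems by (auto intro: continuous_map_from_subtopology_mono)
  moreover have "\<exists>g. C_on k n V g \<and> (\<forall>x\<in>V. ((\<lambda>t. f (x(i := t))) has_real_derivative g x) (at (x i)))"
    if i: "i < n" for i
  proof -
    obtain g where "C_on k n U g" "\<forall>x\<in>U. ((\<lambda>t. f (x(i := t))) has_real_derivative g x) (at (x i))"
      using Suc.prems(1) i by auto
    then show ?thesis using Suc.IH Suc.prems(2) by blast
  qed
  ultimately show ?case by simp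
qed

text \<open>The local derivative witnesses need not be glued: each may be taken to be the one
  function \<open>pd i f\<close>, to which the induction hypothesis applies.\<close>

lemma C_on_local:
  assumes U: "openRn n U"
    and loc: "\<And>x. x \<in> U \<Longrightarrow> \<exists>V. openRn n V \<and> x \<in> V \<and> V \<subseteq> U \<and> C_on k n V f"
  shows "C_on k n U f"
  using loc
proof (induction k arbitrary: f)
  have cont: "continuous_on U f" if loc: "\<And>x. x \<in> U \<Longrightarrow> \<exists>V. openRn n V \<and> x \<in> V \<and> V \<subseteq> U \<and> C_on k n V f"
    for k f
    unfolding continuous_on_eq_continuous_within
  proof
    fix x assume "x \<in> U"
    then obtain V where V: "openRn n V" "x \<in> V" "V \<subseteq> U" "C_on k n V f" using loc by blast
    then obtain T where T: "open T" "V = Rn n \<inter> T" using openRn_iff by blast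
    have "at x within V = at x within U"
      by (rule at_within_nhd[of x T]) (use T V openRn_subset[OF U] in auto)
    moreover have "continuous (at x within V) f"
      using C_on_continuous[OF V(4) openRn_subset[OF V(1)]] V(2) continuous_on_eq_continuous_within by blast
    ultimately show "continuous (at x within U) f" by simp
  qed
  {
    case 0
    show ?case using cont[OF "0"] openRn_subset[OF U] by (simp add: continuous_map_Rn_iff)
  next
    case (Suc k)
    show ?case
    proof (rule C_on_SucI[OF U cont[OF Suc.prems]])
      fix i assume i: "i < n"
      show "C_on k n U (pd i f)"
      proof (rule Suc.IH)
        fix x assume "x \<in> U"
        then obtain V where "openRn n V" "x \<in> V" "V \<subseteq> U" "C_on (Suc k) n V f"
          using Suc.prems by blast
        then show "\<exists>V. openRn n V \<and> x \<in> V \<and> V \<subseteq> U \<and> C_on k n V (pd i f)"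
          using C_on_SucD(1)[of n V k f i] i by blast
      qed
      show "((\<lambda>t. f (x(i := t))) has_real_derivative pd i f x) (at (x i))" if "x \<in> U" for x
      proof -
        obtain V where "openRn n V" "x \<in> V" "C_on (Suc k) n V f" using Suc.prems \<open>x \<in> U\<close> by blast
        then show ?thesis using C_on_SucD(2)[of n V k f i x] i by blast
      qed
    qed
  }
qed

lemma C_on_const: "openRn n U \<Longrightarrow> C_on k n U (\<lambda>x. c)"
proof (induction k arbitrary: c)
  case 0
  then show ?case by simp
next
  case (Suc k)
  show ?case
    by (rule C_on_SucI[where d = "\<lambda>i x. 0"]) (use Suc in auto)
qed

lemma C_on_coord:
  assumes "openRn n U"
  shows "C_on k n U (\<lambda>x. x j)"
proof (cases k)
  case 0
  then show ?thesis
    using openRn_subset[OF assms] by (simp add: continuous_map_Rn_iff continuous_on_coord)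
next
  case (Suc k')
  show ?thesis unfolding Suc
  proof (rule C_on_SucI[where d = "\<lambda>i x. if i = j then 1 else 0"])
    show "C_on k' n U (\<lambda>x. if i = j then 1 else 0)" for i by (rule C_on_const[OF assms])
    show "((\<lambda>t. (x(i := t)) j) has_real_derivative (if i = j then 1 else 0)) (at (x i))" for i x
      by (auto intro!: derivative_eq_intros)
  qed (use assms in \<open>auto intro: continuous_on_coord\<close>)
qed

lemma C_on_add:
  assumes "openRn n U" "C_on k n U f" "C_on k n U g"
  shows "C_on k n U (\<lambda>x. f x + g x)"
  using assms(2,3)
proof (induction k arbitrary: f g)
  case 0
  then show ?case
    using openRn_subset[OF assms(1)] by (simp add: continuous_map_Rn_iff continuous_on_add)
next
  case (Suc k)
  show ?case
  proof (rule C_on_SucI[OF assms(1), where d = "\<lambda>i x. pd i f x + pd i g x"])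
    show "continuous_on U (\<lambda>x. f x + g x)"
      using Suc.prems[THEN C_on_continuous] openRn_subset[OF assms(1)] by (auto intro: continuous_on_add)
    fix i assume i: "i < n"
    note d = C_on_SucD[OF assms(1) Suc.prems(1) i] C_on_SucD[OF assms(1) Suc.prems(2) i]
    show "C_on k n U (\<lambda>x. pd i f x + pd i g x)" using d by (intro Suc.IH)
    show "((\<lambda>t. f (x(i := t)) + g (x(i := t))) has_real_derivative pd i f x + pd i g x) (at (x i))" if "x \<in> U" for x
      using d that by (intro DERIV_add)
  qed
qed

lemma C_on_mult:
  assumes "openRn n U" "C_on k n U f" "C_on k n U g"
  shows "C_on k n U (\<lambda>x. f x * g x)"
  using assms(2,3)
proof (induction k arbitrary: f g)
  case 0
  then show ?case
    using openRn_subset[OF assms(1)] by (simp add: continuous_map_Rn_iff continuous_on_mult)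
next
  case (Suc k)
  show ?case
  proof (rule C_on_SucI[OF assms(1), where d = "\<lambda>i x. f x * pd i g x + pd i f x * g x"])
    show "continuous_on U (\<lambda>x. f x * g x)"
      using Suc.prems[THEN C_on_continuous] openRn_subset[OF assms(1)] by (auto intro: continuous_on_mult)
    fix i assume i: "i < n"
    note d = C_on_SucD[OF assms(1) Suc.prems(1) i] C_on_SucD[OF assms(1) Suc.prems(2) i]
    show "C_on k n U (\<lambda>x. f x * pd i g x + pd i f x * g x)"
      using d Suc.prems[THEN C_on_lower] by (intro C_on_add[OF assms(1)] Suc.IH)
    show "((\<lambda>t. f (x(i := t)) * g (x(i := t))) has_real_derivative f x * pd i g x + pd i f x * g x) (at (x i))"
      if "x \<in> U" for x
      using DERIV_mult'[OF d(2)[OF that] d(4)[OF that]] by (simp del: fun_upd_apply)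
  qed
qed

lemma C_on_sum:
  assumes "openRn n U" "\<And>j. j \<in> S \<Longrightarrow> C_on k n U (f j)"
  shows "C_on k n U (\<lambda>x. \<Sum>j\<in>S. f j x)"
  using assms(2)
  by (induction S rule: infinite_finite_induct)
    (auto intro: C_on_add C_on_const assms(1))

text \<open>The partial derivatives of \<open>1/f\<close> are products of \<open>1/f\<close> itself
  and \<open>pd i f\<close>, so the induction on \<open>k\<close> closes with \<open>f\<close>
  fixed.\<close>

lemma C_on_inverse:
  assumes "openRn n U" "C_on k n U f" "\<And>x. x \<in> U \<Longrightarrow> f x \<noteq> 0"
  shows "C_on k n U (\<lambda>x. inverse (f x))"
  using assms(2)
proof (induction k)
  case 0
  then show ?case
    using openRn_subset[OF assms(1)] assms(3) by (auto simp add: continuous_map_Rn_iff intro: continuous_on_inverse)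
next
  case (Suc k)
  show ?case
  proof (rule C_on_SucI[OF assms(1), where d = "\<lambda>i x. - 1 * (inverse (f x) * pd i f x * inverse (f x))"])
    show "continuous_on U (\<lambda>x. inverse (f x))"
      using Suc.prems[THEN C_on_continuous] assms(3) openRn_subset[OF assms(1)] by (auto intro: continuous_on_inverse)
    fix i assume i: "i < n"
    note d = C_on_SucD[OF assms(1) Suc.prems i]
    show "C_on k n U (\<lambda>x. - 1 * (inverse (f x) * pd i f x * inverse (f x)))"
      using d Suc.prems[THEN C_on_lower]
      by (intro C_on_mult[OF assms(1)] Suc.IH C_on_const[OF assms(1)])
    show "((\<lambda>t. inverse (f (x(i := t)))) has_real_derivative
        - 1 * (inverse (f x) * pd i f x * inverse (f x))) (at (x i))" if "x \<in> U" for x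
      using DERIV_inverse'[OF d(2)[OF that]] assms(3)[OF that] by (simp del: fun_upd_apply)
  qed
qed

section \<open>Caratheodory's form and the chain rule\<close>

text \<open>Coordinates from \<open>n\<close> on vanish at both points, so only \<open>n\<close>
  radii matter and their minimum serves for all coordinates.\<close>

lemma openRn_box:
  assumes "openRn n U" "a \<in> U"
  obtains d where "d > 0" "\<And>y. y \<in> Rn n \<Longrightarrow> (\<And>i. i < n \<Longrightarrow> \<bar>y i - a i\<bar> < d) \<Longrightarrow> y \<in> U"
proof -
  obtain T where T: "open T" "U = Rn n \<inter> T" using assms(1) openRn_iff by blast
  have "openin (product_topology (\<lambda>i. euclideanreal) UNIV) T"
    using T(1) by (simp add: euclidean_product_topology)
  from product_topology_open_contains_basis[OF this, of a]
  obtain X where X: "a \<in> Pi\<^sub>E UNIV X" "\<And>i. open (X i :: real set)" "Pi\<^sub>E UNIV X \<subseteq> T"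
    using T assms(2) by auto
  have "\<exists>e>0. \<forall>t. \<bar>t - a i\<bar> < e \<longrightarrow> t \<in> X i" for i
    using X(2)[of i] X(1) unfolding open_dist by (auto simp: dist_real_def PiE_UNIV_domain)
  then obtain e where e: "\<And>i. e i > 0" "\<And>i t. \<bar>t - a i\<bar> < e i \<Longrightarrow> t \<in> X i" by metis
  \<comment> \<open>The extra \<open>1\<close> keeps the set nonempty when
    \<open>n = 0\<close>.\<close>
  define d where "d = Min (insert 1 (e ` {..<n}))"
  have d: "d > 0" "\<And>i. i < n \<Longrightarrow> d \<le> e i" unfolding d_def using e by auto
  show ?thesis
  proof (rule that[OF d(1)])
    fix y assume y: "y \<in> Rn n" "\<And>i. i < n \<Longrightarrow> \<bar>y i - a i\<bar> < d"
    have "y i \<in> X i" for i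
    proof (cases "i < n")
      case True
      show ?thesis using e(2)[of "y i" i] y(2)[OF True] d(2)[OF True] by linarith
    next
      case False
      have "a \<in> Rn n" using assms openRn_subset by blast
      then show ?thesis using e False y(1) by (auto simp: topspace_Euclidean_space)
    qed
    then show "y \<in> U" using T X(3) y(1) by (auto simp: PiE_UNIV_domain)
  qed
qed

text \<open>Caratheodory's form of differentiability: \<open>A j\<close> is the difference quotient along the \<open>j\<close>-th edge of
  the polygon from \<open>a\<close> to \<open>y\<close> that changes one coordinate at a time.\<close>

lemma C_on_caratheodory:
  assumes U: "openRn n U" and f: "C_on (Suc 0) n U f" and a: "a \<in> U"
  obtains A where
    "\<And>j. j < n \<Longrightarrow> continuous (at a within U) (A j)"
    "\<And>j. j < n \<Longrightarrow> A j a = pd j f a"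
    "\<And>y. y \<in> U \<Longrightarrow> f y - f a = (\<Sum>j<n. A j y * (y j - a j))"
proof -
  define p where "p y j = (\<lambda>i. if i < j then y i else a i)" for y j
  \<comment> \<open>If \<open>y j = a j\<close> the edge degenerates and any value satisfies the
    telescoping identity; \<open>pd j f a\<close> is the one that makes \<open>A j\<close>
    continuous at \<open>a\<close>.\<close>
  define A where "A j y = (if y j = a j then pd j f a else (f (p y (Suc j)) - f (p y j)) / (y j - a j))" for j y
  have aR: "a \<in> Rn n" using a openRn_subset[OF U] by blast
  have step: "f (p y (Suc j)) - f (p y j) = A j y * (y j - a j)" for y j
  proof (cases "y j = a j")
    case True
    have "p y (Suc j) = p y j" using True by (auto simp: p_def less_Suc_eq)
    then show ?thesis using True by (simp add: A_def)
  next
    case False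
    then show ?thesis by (simp add: A_def)
  qed
  have tele: "f y - f a = (\<Sum>j<n. A j y * (y j - a j))" if "y \<in> U" for y
  proof -
    have "(\<Sum>j<n. f (p y (Suc j)) - f (p y j)) = f (p y n) - f (p y 0)"
      by (rule sum_lessThan_telescope)
    \<comment> \<open>Beyond index \<open>n\<close> both sequences vanish, so the last vertex is
      \<open>y\<close> itself.\<close>
    moreover have "p y n = y"
    proof
      show "p y n i = y i" for i
        using subsetD[OF openRn_subset[OF U] that] aR by (auto simp: p_def topspace_Euclidean_space)
    qed
    moreover have "p y 0 = a" by (simp add: p_def)
    ultimately show ?thesis by (simp add: step)
  qed
  have cont: "continuous (at a within U) (A j)" if j: "j < n" for j
    unfolding continuous_within tendsto_iff
  proof (intro allI impI)
    fix e :: real assume e: "e > 0"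
    have "continuous_on U (pd j f)"
      using C_on_SucD(1)[OF U f j] C_on_continuous openRn_subset[OF U] by blast
    then obtain T where T: "open T" "\<And>x. x \<in> U \<Longrightarrow> x \<in> T \<longleftrightarrow> dist (pd j f x) (pd j f a) < e"
      unfolding continuous_on_open_invariant
      by (metis (no_types, lifting) Int_iff mem_ball open_ball vimage_eq dist_commute)
    have "openRn n (U \<inter> T)" using U T(1) unfolding openRn_iff by (metis inf.assoc open_Int)
    moreover have "a \<in> U \<inter> T" using a T(2) e by simp
    ultimately obtain r where r: "r > 0" "\<And>y. y \<in> Rn n \<Longrightarrow> (\<And>i. i < n \<Longrightarrow> \<bar>y i - a i\<bar> < r) \<Longrightarrow> y \<in> U \<inter> T"
      using openRn_box by metis
    have near: "dist (A j y) (A j a) < e" if y: "y \<in> U" "\<And>i. i < n \<Longrightarrow> \<bar>y i - a i\<bar> < r" for y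
    proof (cases "y j = a j")
      case True
      then show ?thesis using e by (simp add: A_def)
    next
      case False
      \<comment> \<open>\<open>q\<close> runs along the line of the \<open>j\<close>-th edge. By the
        mean value theorem the difference quotient is \<open>pd j f\<close> at some point of that
        edge, which lies in the box where \<open>pd j f\<close> is within \<open>e\<close> of its
        value at \<open>a\<close>.\<close>
      define q where "q t = (p y j)(j := t)" for t
      have q: "q t \<in> U \<inter> T" if t: "\<bar>t - a j\<bar> < r" for t
      proof (rule r(2))
        show "q t \<in> Rn n" using aR j y(1) openRn_subset[OF U] by (auto simp: topspace_Euclidean_space q_def p_def)
        show "\<bar>q t i - a i\<bar> < r" if "i < n" for i
          using t y(2)[OF that] r(1) by (auto simp: q_def p_def)
      qed
      have der: "((\<lambda>t. f (q t)) has_real_derivative pd j f (q t)) (at t)" if t: "\<bar>t - a j\<bar> < r" for t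
        using C_on_SucD(2)[OF U f j, of "q t"] q[OF t] by (auto simp: q_def)
      have ends: "q (y j) = p y (Suc j)" "q (a j) = p y j"
        by (auto simp: q_def p_def less_Suc_eq)
      have "\<exists>t. \<bar>t - a j\<bar> < r \<and> f (q (y j)) - f (q (a j)) = (y j - a j) * pd j f (q t)"
      proof (cases "a j < y j")
        case True
        from MVT2[OF True, of "\<lambda>t. f (q t)" "\<lambda>t. pd j f (q t)"] der y(2)[OF j]
        obtain t where "a j < t" "t < y j" "f (q (y j)) - f (q (a j)) = (y j - a j) * pd j f (q t)"
          by auto
        then show ?thesis using y(2)[OF j] by (intro exI[of _ t]) auto
      next
        case False
        then have less: "y j < a j" using \<open>y j \<noteq> a j\<close> by simp
        from MVT2[OF less, of "\<lambda>t. f (q t)" "\<lambda>t. pd j f (q t)"] der y(2)[OF j]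
        obtain t where "y j < t" "t < a j" "f (q (a j)) - f (q (y j)) = (a j - y j) * pd j f (q t)"
          by auto
        then show ?thesis using y(2)[OF j] by (intro exI[of _ t]) (auto simp: algebra_simps)
      qed
      then obtain t where t: "\<bar>t - a j\<bar> < r" "f (q (y j)) - f (q (a j)) = (y j - a j) * pd j f (q t)" by blast
      have "A j y = pd j f (q t)" using t(2) False by (simp add: A_def ends)
      moreover have "A j a = pd j f a" by (simp add: A_def)
      ultimately show ?thesis using q[OF t(1)] T(2) by auto
    qed
    have "\<forall>\<^sub>F y in at a within U. \<forall>i\<in>{..<n}. \<bar>y i - a i\<bar> < r"
    proof (rule eventually_ball_finite)
      show "\<forall>i\<in>{..<n}. \<forall>\<^sub>F y in at a within U. \<bar>y i - a i\<bar> < r"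
      proof
        fix i
        have "((\<lambda>y. y i) \<longlongrightarrow> a i) (at a within U)"
          using continuous_on_coord[of U i] a by (simp add: continuous_on_def)
        then show "\<forall>\<^sub>F y in at a within U. \<bar>y i - a i\<bar> < r"
          using r(1) by (auto simp: tendsto_iff dist_real_def)
      qed
    qed simp
    moreover have "\<forall>\<^sub>F y in at a within U. y \<in> U" by (simp add: eventually_at_filter)
    ultimately show "\<forall>\<^sub>F y in at a within U. dist (A j y) (A j a) < e"
      by eventually_elim (use near in auto)
  qed
  show ?thesis
    by (rule that[of A]) (use cont tele in \<open>auto simp: A_def\<close>)
qed

lemma tendsto_coordinatewise:
  fixes \<gamma> :: "'b \<Rightarrow> 'i \<Rightarrow> 'c::topological_space"
  assumes "\<And>i. ((\<lambda>t. \<gamma> t i) \<longlongrightarrow> a i) F"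
  shows "(\<gamma> \<longlongrightarrow> a) F"
proof -
  have "limitin (product_topology (\<lambda>i. euclidean) UNIV) \<gamma> a F"
    using assms by (simp add: limitin_componentwise)
  then show ?thesis by (simp add: euclidean_product_topology)
qed

text \<open>Convergence of the curve is coordinatewise: the coordinates below \<open>n\<close>
  converge by assumption, and the others are eventually constant because the curve stays in
  \<open>U\<close>.\<close>

lemma tendsto_along_curve:
  assumes U: "openRn n U" and A: "continuous (at (\<gamma> s) within U) A"
    and \<gamma>: "\<forall>\<^sub>F t in nhds s. \<gamma> t \<in> U"
    and c: "\<And>j. j < n \<Longrightarrow> isCont (\<lambda>t. \<gamma> t j) s"
  shows "((\<lambda>t. A (\<gamma> t)) \<longlongrightarrow> A (\<gamma> s)) (at s)"
proof -
  have ev: "\<forall>\<^sub>F t in at s. \<gamma> t \<in> U" using \<gamma> by (simp add: eventually_nhds_conv_at)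
  have s: "\<gamma> s \<in> U" using \<gamma> eventually_nhds_x_imp_x by fastforce
  have R: "x i = 0" if "x \<in> U" "\<not> i < n" for x i
    using that openRn_subset[OF U] by (auto simp: topspace_Euclidean_space)
  have lim: "(\<gamma> \<longlongrightarrow> \<gamma> s) (at s)"
  proof (rule tendsto_coordinatewise)
    fix i
    show "((\<lambda>t. \<gamma> t i) \<longlongrightarrow> \<gamma> s i) (at s)"
    proof (cases "i < n")
      case True
      then show ?thesis using c isCont_def by blast
    next
      case False
      have "\<forall>\<^sub>F t in at s. \<gamma> t i = \<gamma> s i"
        using ev by eventually_elim (metis R False s)
      then show ?thesis by (rule tendsto_eventually)
    qed
  qed
  show ?thesis
    unfolding tendsto_def
  proof (intro allI impI)
    fix S assume S: "open S" "A (\<gamma> s) \<in> S"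
    \<comment> \<open>The curve may return to \<open>\<gamma> s\<close> for \<open>t\<close> near
      \<open>s\<close>, so the punctured filter has to be completed to a full neighbourhood
      filter.\<close>
    have "\<forall>\<^sub>F y in nhds (\<gamma> s). y \<in> U \<longrightarrow> A y \<in> S"
    proof -
      have "\<forall>\<^sub>F y in at (\<gamma> s) within U. A y \<in> S"
        using A S unfolding continuous_within tendsto_def by blast
      then have "\<forall>\<^sub>F y in nhds (\<gamma> s). y \<noteq> \<gamma> s \<longrightarrow> y \<in> U \<longrightarrow> A y \<in> S"
        by (simp add: eventually_at_filter)
      then show ?thesis by eventually_elim (use S in auto)
    qed
    then have "\<forall>\<^sub>F t in at s. \<gamma> t \<in> U \<longrightarrow> A (\<gamma> t) \<in> S"
      by (rule eventually_compose_filterlim[OF _ lim])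
    then show "\<forall>\<^sub>F t in at s. A (\<gamma> t) \<in> S" using ev by eventually_elim auto
  qed
qed

text \<open>Divided by \<open>t - s\<close>, Caratheodory's identity at \<open>\<gamma> s\<close> is
  a finite sum of products in which each factor converges; the limit is taken term by term.\<close>

lemma C_on_chain_curve:
  assumes U: "openRn n U" and f: "C_on (Suc 0) n U f"
    and \<gamma>: "\<forall>\<^sub>F t in nhds s. \<gamma> t \<in> U"
    and d: "\<And>j. j < n \<Longrightarrow> ((\<lambda>t. \<gamma> t j) has_real_derivative d j) (at s)"
  shows "((\<lambda>t. f (\<gamma> t)) has_real_derivative (\<Sum>j<n. pd j f (\<gamma> s) * d j)) (at s)"
proof -
  have s: "\<gamma> s \<in> U" using \<gamma> eventually_nhds_x_imp_x by fastforce
  obtain A where A: "\<And>j. j < n \<Longrightarrow> continuous (at (\<gamma> s) within U) (A j)"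
    "\<And>j. j < n \<Longrightarrow> A j (\<gamma> s) = pd j f (\<gamma> s)"
    "\<And>y. y \<in> U \<Longrightarrow> f y - f (\<gamma> s) = (\<Sum>j<n. A j y * (y j - \<gamma> s j))"
    by (rule C_on_caratheodory[OF U f s]) (rule that)
  have "((\<lambda>t. \<Sum>j<n. A j (\<gamma> t) * ((\<gamma> t j - \<gamma> s j) / (t - s))) \<longlongrightarrow> (\<Sum>j<n. A j (\<gamma> s) * d j)) (at s)"
    using d A(1) DERIV_isCont[OF d]
    by (intro tendsto_sum tendsto_mult tendsto_along_curve[OF U _ \<gamma>])
      (auto simp: has_field_derivative_iff)
  moreover have "\<forall>\<^sub>F t in at s. (\<Sum>j<n. A j (\<gamma> t) * ((\<gamma> t j - \<gamma> s j) / (t - s)))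
      = (f (\<gamma> t) - f (\<gamma> s)) / (t - s)"
  proof -
    have "\<forall>\<^sub>F t in at s. \<gamma> t \<in> U" using \<gamma> by (simp add: eventually_nhds_conv_at)
    then show ?thesis by eventually_elim (simp add: A(3) sum_divide_distrib)
  qed
  ultimately have "((\<lambda>t. (f (\<gamma> t) - f (\<gamma> s)) / (t - s)) \<longlongrightarrow> (\<Sum>j<n. A j (\<gamma> s) * d j)) (at s)"
    by (rule Lim_transform_eventually)
  then show ?thesis by (simp add: has_field_derivative_iff A(2))
qed

lemma continuous_on_into_Rn:
  fixes g :: "(nat \<Rightarrow> real) \<Rightarrow> nat \<Rightarrow> real"
  assumes "\<And>j. j < n \<Longrightarrow> continuous_on V (\<lambda>x. g x j)" "g ` V \<subseteq> Rn n"
  shows "continuous_on V g"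
proof (rule continuous_on_coordinatewise_then_product)
  fix j
  show "continuous_on V (\<lambda>x. g x j)"
  proof (cases "j < n")
    case False
    then have "g x j = 0" if "x \<in> V" for x using assms(2) that by (auto simp: topspace_Euclidean_space)
    then show ?thesis by (simp cong: continuous_on_cong)
  qed (use assms in auto)
qed

lemma C_on_chain:
  assumes U: "openRn n U" and V: "openRn m V" and gV: "g ` V \<subseteq> U"
    and f: "C_on (Suc 0) n U f" and g: "\<And>j. j < n \<Longrightarrow> C_on (Suc 0) m V (\<lambda>x. g x j)"
    and i: "i < m" and x: "x \<in> V"
  shows "((\<lambda>t. f (g (x(i := t)))) has_real_derivative
    (\<Sum>j<n. pd j f (g x) * pd i (\<lambda>x. g x j) x)) (at (x i))"
proof -
  have "\<forall>\<^sub>F t in nhds (x i). g (x(i := t)) \<in> U"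
    using eventually_fun_upd[OF V x i] by eventually_elim (use gV in auto)
  from C_on_chain_curve[OF U f this, OF C_on_SucD(2)[OF V g i x]]
  show ?thesis by (simp del: fun_upd_apply)
qed

text \<open>By the chain rule the partial derivatives are sums of products of \<open>pd j f\<close>
  after \<open>g\<close> with partial derivatives of the components of \<open>g\<close>. The
  induction hypothesis covers the first factor, with \<open>pd j f\<close> in place of
  \<open>f\<close> and the smoothness of \<open>g\<close> lowered by one.\<close>

lemma C_on_compose:
  assumes U: "openRn n U" and V: "openRn m V" and gV: "g ` V \<subseteq> U"
    and "C_on k n U f" and "\<And>j. j < n \<Longrightarrow> C_on k m V (\<lambda>x. g x j)"
  shows "C_on k m V (\<lambda>x. f (g x))"
  using assms(4,5)
proof (induction k arbitrary: f)
  have cont: "continuous_on V (\<lambda>x. f (g x))"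
    if "C_on k n U f" "\<And>j. j < n \<Longrightarrow> C_on k m V (\<lambda>x. g x j)" for k f
  proof (rule continuous_on_compose2[of U f])
    show "continuous_on U f" using that(1) C_on_continuous openRn_subset[OF U] by blast
    show "continuous_on V g"
      by (rule continuous_on_into_Rn[of n])
        (use that(2) C_on_continuous openRn_subset[OF V] openRn_subset[OF U] gV in blast)+
  qed (rule gV)
  {
    case 0
    show ?case using cont[OF 0] openRn_subset[OF V] by (simp add: continuous_map_Rn_iff)
  next
    case (Suc k)
    have f1: "C_on (Suc 0) n U f" and g1: "\<And>j. j < n \<Longrightarrow> C_on (Suc 0) m V (\<lambda>x. g x j)"
    proof -
      have low: "C_on (Suc k) n U f \<Longrightarrow> C_on (Suc 0) n U f" for n U f
        by (induction k) (auto dest: C_on_lower simp del: C_on.simps)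
      show "C_on (Suc 0) n U f" "\<And>j. j < n \<Longrightarrow> C_on (Suc 0) m V (\<lambda>x. g x j)"
        using low Suc.prems by blast+
    qed
    show ?case
    proof (rule C_on_SucI[OF V cont[OF Suc.prems]])
      fix i assume i: "i < m"
      show "C_on k m V (\<lambda>x. \<Sum>j<n. pd j f (g x) * pd i (\<lambda>x. g x j) x)"
      proof (intro C_on_sum C_on_mult V)
        fix j assume "j \<in> {..<n}"
        then have j: "j < n" by simp
        show "C_on k m V (\<lambda>x. pd j f (g x))"
          by (rule Suc.IH[OF C_on_SucD(1)[OF U Suc.prems(1) j]]) (rule C_on_lower[OF Suc.prems(2)])
        show "C_on k m V (pd i (\<lambda>x. g x j))"
          by (rule C_on_SucD(1)[OF V Suc.prems(2)[OF j] i])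
      qed
      show "((\<lambda>t. f (g (x(i := t)))) has_real_derivative
          (\<Sum>j<n. pd j f (g x) * pd i (\<lambda>x. g x j) x)) (at (x i))" if "x \<in> V" for x
        by (rule C_on_chain[OF U V gV f1 g1 i that])
    qed
  }
qed

section \<open>Solving for one coordinate\<close>

lemma openRn_preimage:
  assumes "openRn n U" "continuous_on U g" "open T"
  shows "openRn n {x\<in>U. g x \<in> T}"
proof -
  obtain S where S: "open S" "S \<inter> U = g -` T \<inter> U"
    using assms(2,3) unfolding continuous_on_open_invariant by blast
  obtain R where R: "open R" "U = Rn n \<inter> R" using assms(1) openRn_iff by blast
  have "{x\<in>U. g x \<in> T} = Rn n \<inter> (R \<inter> S)" using S R by auto
  then show ?thesis unfolding openRn_iff using S(1) R(1) by blast
qed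

lemma openRn_less:
  fixes f g :: "(nat \<Rightarrow> real) \<Rightarrow> real"
  assumes "openRn n U" "continuous_on U f" "continuous_on U g"
  shows "openRn n {x\<in>U. f x < g x}"
  using openRn_preimage[OF assms(1) continuous_on_diff[OF assms(3,2)], of "{0<..}"] by simp

lemma eventually_openRn:
  assumes "openRn n V" "x \<in> V" "W \<subseteq> Rn n"
  shows "\<forall>\<^sub>F y in at x within W. y \<in> V"
proof -
  obtain T where T: "open T" "V = Rn n \<inter> T" using assms(1) openRn_iff by blast
  show ?thesis unfolding eventually_at_topological using T assms by blast
qed

text \<open>The substitution taking \<open>w\<close> to \<open>w(i := h w)\<close> is a local right
  inverse of the map taking \<open>x\<close> to \<open>x(i := f x)\<close>. It exists because
  \<open>f\<close> is strictly monotone in the \<open>i\<close>-th coordinate near \<open>z\<close>.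
  The last conclusion makes the Jacobian of the substitution invertible.\<close>

lemma implicit_coordinate:
  assumes U: "openRn n U" and f: "\<And>k. C_on k n U f" and i: "i < n"
    and z: "z \<in> U" and nz: "pd i f z \<noteq> 0"
  obtains W h where "openRn n W" "z(i := f z) \<in> W" "h (z(i := f z)) = z i" "\<And>k. C_on k n W h"
    "\<And>w. w \<in> W \<Longrightarrow> w(i := h w) \<in> U" "\<And>w. w \<in> W \<Longrightarrow> f (w(i := h w)) = w i"
    "\<And>w. w \<in> W \<Longrightarrow> pd i h w \<noteq> 0"
proof -
  note UR = openRn_subset[OF U]
  \<comment> \<open>Multiplication by \<open>c\<close> makes the \<open>i\<close>-th partial
    derivative positive near \<open>z\<close> whatever its sign, so that only increasing functions
    occur.\<close>
  define c where "c = pd i f z"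
  have contf: "continuous_on U f" using f C_on_continuous UR by blast
  have contpd: "continuous_on U (pd i f)" using C_on_SucD(1)[OF U f i] C_on_continuous UR by blast
  define N where "N = {x\<in>U. 0 < c * pd i f x}"
  have N: "openRn n N" unfolding N_def
    by (intro openRn_less U continuous_intros contpd)
  have "z \<in> N" using z nz by (simp add: N_def c_def zero_less_mult_iff) linarith
  then obtain r where r: "r > 0" "\<And>y. y \<in> Rn n \<Longrightarrow> (\<And>l. l < n \<Longrightarrow> \<bar>y l - z l\<bar> < r) \<Longrightarrow> y \<in> N"
    using openRn_box[OF N] by metis
  \<comment> \<open>The coordinate \<open>i\<close> is left free: in \<open>w\<close> it holds the
    prescribed value of \<open>f\<close>, not a position near \<open>z i\<close>.\<close>
  define B where "B = {w\<in>Rn n. \<forall>l<n. l \<noteq> i \<longrightarrow> \<bar>w l - z l\<bar> < r}"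
  have BN: "w(i := s) \<in> N" if "w \<in> B" "\<bar>s - z i\<bar> < r" for w s
    by (rule r(2)) (use that fun_upd_Rn[OF _ i] in \<open>auto simp: B_def\<close>)
  have B: "openRn n B"
  proof -
    have "B = Rn n \<inter> (\<Inter>l\<in>{..<n} - {i}. (\<lambda>w. w l) -` ball (z l) r)"
      by (auto simp: B_def dist_real_def abs_minus_commute)
    moreover have "open (\<Inter>l\<in>{..<n} - {i}. (\<lambda>w. w l) -` ball (z l) r)"
      by (intro open_INT ballI open_vimage continuous_on_coord) auto
    ultimately show ?thesis unfolding openRn_iff by blast
  qed
  have mono: "c * f (w(i := s)) < c * f (w(i := s'))"
    if w: "w \<in> B" and s: "\<bar>s - z i\<bar> < r" "\<bar>s' - z i\<bar> < r" "s < s'" for w s s'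
  proof (rule DERIV_pos_imp_increasing[OF s(3)])
    fix t assume "s \<le> t" "t \<le> s'"
    then have t: "w(i := t) \<in> N" using s by (intro BN w) linarith
    have "((\<lambda>t. f (w(i := t))) has_real_derivative pd i f (w(i := t))) (at t)"
      using C_on_SucD(2)[OF U f i, of "w(i := t)"] t by (simp add: N_def)
    then show "\<exists>y. ((\<lambda>t. c * f (w(i := t))) has_real_derivative y) (at t) \<and> 0 < y"
      using t by (intro exI[of _ "c * pd i f (w(i := t))"]) (auto simp: N_def intro: DERIV_cmult)
  qed
  \<comment> \<open>Half the radius, so that the closed interval lies inside the open one on which
    monotonicity is known.\<close>
  define lo hi where "lo = z i - r / 2" and "hi = z i + r / 2"
  have near: "\<bar>s - z i\<bar> < r" if "lo \<le> s" "s \<le> hi" for s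
    using that r(1) by (auto simp: lo_def hi_def)
  have contB: "continuous_on B (\<lambda>w. c * f (w(i := s)))" if "lo \<le> s" "s \<le> hi" for s
  proof (intro continuous_on_mult_left continuous_on_compose2[OF contf] continuous_on_fun_upd continuous_on_id continuous_on_const)
    show "(\<lambda>w. w(i := s)) ` B \<subseteq> U" using BN near[OF that] by (auto simp: N_def)
  qed
  define solves where "solves w s \<longleftrightarrow> lo < s \<and> s < hi \<and> f (w(i := s)) = w i" for w s
  have ivt: "\<exists>s. s1 < s \<and> s < s2 \<and> solves w s"
    if w: "w \<in> B" and s: "lo \<le> s1" "s1 < s2" "s2 \<le> hi"
      and v: "c * f (w(i := s1)) < c * w i" "c * w i < c * f (w(i := s2))" for w s1 s2
  proof -
    have "continuous_on {s1..s2} (\<lambda>s. c * f (w(i := s)))"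
    proof (intro continuous_on_mult_left continuous_on_compose2[OF contf] continuous_on_fun_upd continuous_on_id continuous_on_const)
      show "(\<lambda>s. w(i := s)) ` {s1..s2} \<subseteq> U" using BN[OF w near] s by (auto simp: N_def)
    qed
    then obtain s where "s1 \<le> s" "s \<le> s2" "c * f (w(i := s)) = c * w i"
      using IVT'[of "\<lambda>s. c * f (w(i := s))" s1 "c * w i" s2] v s by auto
    moreover from this have "s \<noteq> s1" "s \<noteq> s2" using v by auto
    moreover have "c \<noteq> 0" using nz by (simp add: c_def)
    ultimately show ?thesis using s by (intro exI[of _ s]) (auto simp: solves_def)
  qed
  \<comment> \<open>By strict monotonicity there is at most one solution, so on \<open>B\<close> the
    choice is forced wherever a solution exists.\<close>
  define h where "h w = (SOME s. solves w s)" for w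
  have h_eq: "h w = s" if "w \<in> B" "solves w s" for w s
  proof -
    have "solves w (h w)" unfolding h_def using that(2) by (rule someI)
    then show ?thesis
      using mono[OF that(1), of s "h w"] mono[OF that(1), of "h w" s] that(2) near
      by (auto simp: solves_def intro: linorder_cases[of "h w" s])
  qed
  \<comment> \<open>The two inequalities force the solution strictly between \<open>s1\<close> and
    \<open>s2\<close>, and they are open conditions on \<open>w\<close>. With the ends
    \<open>lo\<close> and \<open>hi\<close> they give the domain \<open>W\<close>; with ends close
    to \<open>h x\<close> they give continuity of \<open>h\<close> at \<open>x\<close>.\<close>
  define V where "V s1 s2 = {w \<in> {w\<in>B. c * f (w(i := s1)) < c * w i}. c * w i < c * f (w(i := s2))}" for s1 s2
  have V: "openRn n (V s1 s2)" if "lo \<le> s1" "s1 \<le> hi" "lo \<le> s2" "s2 \<le> hi" for s1 s2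
    unfolding V_def
    by (intro openRn_less B contB that continuous_intros continuous_on_subset[OF contB[of s2]]) auto
  define W where "W = V lo hi"
  have WB: "W \<subseteq> B" by (auto simp: W_def V_def)
  have lohi: "lo < hi" using r(1) by (simp add: lo_def hi_def)
  have W: "openRn n W" unfolding W_def using lohi by (intro V) auto
  note WR = openRn_subset[OF W]
  have sol: "solves w (h w)" if w: "w \<in> W" for w
  proof -
    have "\<exists>s. lo < s \<and> s < hi \<and> solves w s"
      by (rule ivt) (use w lohi in \<open>auto simp: W_def V_def\<close>)
    then show ?thesis using h_eq w WB by blast
  qed
  have \<sigma>N: "w(i := h w) \<in> N" if w: "w \<in> W" for w
    using sol[OF w] WB w by (intro BN near) (auto simp: solves_def)
  have pd_nz: "pd i f (w(i := h w)) \<noteq> 0" if "w \<in> W" for w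
    using \<sigma>N[OF that] by (auto simp: N_def)
  have fh: "f (w(i := h w)) = w i" if w: "w \<in> W" for w
    using sol[OF w] by (simp add: solves_def)
  have conth: "continuous_on W h"
    unfolding continuous_on_def tendsto_iff
  proof (intro ballI allI impI)
    fix x and e :: real assume x: "x \<in> W" and e: "e > 0"
    \<comment> \<open>Clipping at \<open>lo\<close> and \<open>hi\<close> keeps both ends where
      monotonicity holds.\<close>
    define s1 s2 where "s1 = max lo (h x - e / 2)" and "s2 = min hi (h x + e / 2)"
    have s: "lo \<le> s1" "s1 < h x" "h x < s2" "s2 \<le> hi"
      using sol[OF x] e by (auto simp: s1_def s2_def solves_def)
    have "x \<in> V s1 s2"
      using mono[of x s1 "h x"] mono[of x "h x" s2] near s x WB fh[OF x] by (auto simp: V_def)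
    moreover have "openRn n (V s1 s2)" using s by (intro V) auto
    ultimately have "\<forall>\<^sub>F y in at x within W. y \<in> V s1 s2" using eventually_openRn WR by blast
    then show "\<forall>\<^sub>F y in at x within W. dist (h y) (h x) < e"
    proof eventually_elim
      case (elim y)
      then have y: "y \<in> B" by (auto simp: V_def)
      have "\<exists>t. s1 < t \<and> t < s2 \<and> solves y t"
        by (rule ivt) (use elim y s in \<open>auto simp: V_def\<close>)
      then have "s1 < h y" "h y < s2" using h_eq[OF y] by auto
      then show ?case by (auto simp: s1_def s2_def dist_real_def)
    qed
  qed
  \<comment> \<open>Implicit differentiation of \<open>f (w(i := h w)) = w i\<close> in direction
    \<open>l\<close>. For \<open>l = i\<close> the right side contributes 1 and the coordinate
    \<open>w i\<close> no longer occurs on the left except through \<open>h\<close>; for other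
    \<open>l\<close> the right side is constant and \<open>w l\<close> occurs directly, contributing
    \<open>- pd l f\<close>.\<close>
  define D where "D l w = (if l = i then 1 else - 1 * pd l f (w(i := h w))) * inverse (pd i f (w(i := h w)))" for l w
  have der: "((\<lambda>t. h (w(l := t))) has_real_derivative D l w) (at (w l))" if l: "l < n" and w: "w \<in> W" for l w
  proof -
    define a where "a = w(i := h w)"
    define \<gamma> where "\<gamma> t = (w(l := t))(i := h (w(l := t)))" for t
    have \<gamma>s: "\<gamma> (w l) = a" by (simp add: \<gamma>_def a_def)
    have "a \<in> N" using \<sigma>N[OF w] by (simp add: a_def)
    then have a: "a \<in> U" and pda: "pd i f a \<noteq> 0" by (auto simp: N_def)
    have evW: "\<forall>\<^sub>F t in nhds (w l). w(l := t) \<in> W" by (rule eventually_fun_upd[OF W w l])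
    then have ev\<gamma>: "\<forall>\<^sub>F t in nhds (w l). \<gamma> t \<in> U"
      by eventually_elim (use \<sigma>N in \<open>auto simp: \<gamma>_def N_def\<close>)
    \<comment> \<open>The chain rule would presuppose a derivative of \<open>h\<close>. Along
      \<open>\<gamma>\<close>, Caratheodory's identity can instead be solved for the difference
      quotient of \<open>h\<close>, and passing to the limit takes only the continuity of
      \<open>h\<close>.\<close>
    obtain A where A: "\<And>j. j < n \<Longrightarrow> continuous (at a within U) (A j)"
      "\<And>j. j < n \<Longrightarrow> A j a = pd j f a"
      "\<And>y. y \<in> U \<Longrightarrow> f y - f a = (\<Sum>j<n. A j y * (y j - a j))"
      by (rule C_on_caratheodory[OF U f a]) (rule that)
    have cw: "isCont (\<lambda>t. (w(l := t)) j) (w l)" for j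
      by (cases "j = l") (auto intro: continuous_intros)
    have "continuous (at w within W) h" using conth w continuous_on_eq_continuous_within by blast
    then have "((\<lambda>t. h (w(l := t))) \<longlongrightarrow> h (w(l := w l))) (at (w l))"
      using tendsto_along_curve[OF W, where A = h and s = "w l" and \<gamma> = "\<lambda>t. w(l := t)"] evW cw
      by (simp del: fun_upd_apply)
    then have ch: "isCont (\<lambda>t. h (w(l := t))) (w l)" by (simp add: isCont_def)
    have c\<gamma>: "isCont (\<lambda>t. \<gamma> t j) (w l)" for j
      unfolding \<gamma>_def using ch cw[of j] by (cases "j = i") (auto simp del: fun_upd_apply simp: fun_upd_same fun_upd_other)
    have limA: "((\<lambda>t. A j (\<gamma> t)) \<longlongrightarrow> pd j f a) (at (w l))" if "j < n" for j
      using tendsto_along_curve[where \<gamma> = \<gamma> and s = "w l" and A = "A j", OF U _ ev\<gamma> c\<gamma>]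
        A(1,2)[OF that] by (simp add: \<gamma>s)
    have "((\<lambda>t. (if l = i then 1 else - 1 * A l (\<gamma> t)) * inverse (A i (\<gamma> t))) \<longlongrightarrow> D l w) (at (w l))"
      unfolding D_def using limA[OF l] limA[OF i] pda
      by (auto simp: a_def intro!: tendsto_intros)
    moreover have "\<forall>\<^sub>F t in at (w l). (if l = i then 1 else - 1 * A l (\<gamma> t)) * inverse (A i (\<gamma> t))
        = (h (w(l := t)) - h (w(l := w l))) / (t - w l)"
    proof -
      have "\<forall>\<^sub>F t in at (w l). A i (\<gamma> t) \<noteq> 0"
        by (rule tendsto_imp_eventually_ne[OF limA[OF i] pda])
      moreover have "\<forall>\<^sub>F t in at (w l). w(l := t) \<in> W" "\<forall>\<^sub>F t in at (w l). \<gamma> t \<in> U"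
        using evW ev\<gamma> by (simp_all add: eventually_nhds_conv_at)
      moreover have "\<forall>\<^sub>F t in at (w l). t \<noteq> w l" by (simp add: eventually_at_filter)
      ultimately show ?thesis
      proof eventually_elim
        case (elim t)
        have \<gamma>a: "\<gamma> t i = h (w(l := t))" "a i = h w" by (simp_all add: \<gamma>_def a_def)
        have "(\<Sum>j<n. A j (\<gamma> t) * (\<gamma> t j - a j)) = A i (\<gamma> t) * (\<gamma> t i - a i) +
            (\<Sum>j\<in>{..<n} - {i}. A j (\<gamma> t) * (\<gamma> t j - a j))"
          using i by (intro sum.remove) auto
        \<comment> \<open>Apart from coordinate \<open>i\<close>, only coordinate \<open>l\<close>
          moves along \<open>\<gamma>\<close>.\<close>
        also have "(\<Sum>j\<in>{..<n} - {i}. A j (\<gamma> t) * (\<gamma> t j - a j)) =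
            (\<Sum>j\<in>{..<n} - {i}. if j = l then A l (\<gamma> t) * (t - w l) else 0)"
          by (intro sum.cong) (auto simp: \<gamma>_def a_def)
        also have "\<dots> = (if l = i then 0 else A l (\<gamma> t) * (t - w l))"
          using l by (auto simp: sum.delta)
        finally have "A i (\<gamma> t) * (h (w(l := t)) - h w) + (if l = i then 0 else A l (\<gamma> t) * (t - w l))
            = f (\<gamma> t) - f a"
          using A(3)[OF elim(3)] by (simp only: \<gamma>a)
        also have "\<dots> = (w(l := t)) i - w i"
          using fh[OF elim(2)] fh[OF w] by (simp add: \<gamma>_def a_def del: fun_upd_apply)
        finally show ?case using elim(1,4)
          by (cases "l = i") (auto simp: field_simps fun_upd_triv simp del: fun_upd_apply simp: fun_upd_same fun_upd_other)
      qed
    qed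
    ultimately show ?thesis
      unfolding has_field_derivative_iff by (rule Lim_transform_eventually)
  qed
  have Ch: "C_on k n W h" for k
  proof (induction k)
    case 0
    show ?case using conth WR by (simp add: continuous_map_Rn_iff)
  next
    case (Suc k)
    have \<sigma>: "C_on k n W (\<lambda>w. (w(i := h w)) j)" for j
      by (cases "j = i") (simp_all add: Suc.IH C_on_coord[OF W])
    have pd\<sigma>: "C_on k n W (\<lambda>w. pd l f (w(i := h w)))" if "l < n" for l
      by (rule C_on_compose[where g = "\<lambda>w. w(i := h w)", OF U W _ C_on_SucD(1)[OF U f that] \<sigma>])
        (use \<sigma>N in \<open>auto simp: N_def\<close>)
    show ?case
    proof (rule C_on_SucI[OF W conth _ der])
      fix l assume l: "l < n"
      have inv: "C_on k n W (\<lambda>w. inverse (pd i f (w(i := h w))))"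
        by (rule C_on_inverse[OF W pd\<sigma>[OF i] pd_nz])
      have "C_on k n W (\<lambda>w. - 1 * pd l f (w(i := h w)))"
        by (rule C_on_mult[OF W C_on_const[OF W] pd\<sigma>[OF l]])
      then have "C_on k n W (\<lambda>w. if l = i then 1 else - 1 * pd l f (w(i := h w)))"
        by (cases "l = i") (simp_all add: C_on_const[OF W])
      then show "C_on k n W (D l)" unfolding D_def using inv by (rule C_on_mult[OF W])
    qed
  qed
  show ?thesis
  proof (rule that[OF W _ _ Ch _ fh])
    have zB: "z \<in> B" using z UR r(1) by (auto simp: B_def)
    have "lo < z i" "z i < hi" using r(1) by (simp_all add: lo_def hi_def)
    then have "c * f (z(i := lo)) < c * f z" "c * f z < c * f (z(i := hi))"
      using mono[OF zB near near, of lo "z i"] mono[OF zB near near, of "z i" hi] by simp_all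
    then show zW: "z(i := f z) \<in> W"
      using zB fun_upd_Rn[OF _ i] by (simp add: W_def V_def B_def)
    show "h (z(i := f z)) = z i"
      by (rule h_eq) (use zW WB r(1) in \<open>auto simp: solves_def lo_def hi_def simp del: fun_upd_apply simp: fun_upd_same\<close>)
    show "w(i := h w) \<in> U" if "w \<in> W" for w using \<sigma>N[OF that] by (simp add: N_def)
    show "pd i h w \<noteq> 0" if "w \<in> W" for w
      using DERIV_imp_deriv[OF der[OF i that]] pd_nz[OF that] by (simp add: pd_def D_def)
  qed
qed

section \<open>Local sections of submersions\<close>

lemma smooth_euclid_compose:
  assumes "openRn n U" "openRn m V" "smooth_euclid n U p f" "smooth_euclid m V n g" "g ` V \<subseteq> U"
  shows "smooth_euclid m V p (\<lambda>x. f (g x))"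
  using assms C_on_compose[OF assms(1,2,5)] unfolding smooth_euclid_def by fastforce

lemma smooth_euclid_cong:
  assumes "openRn n U" "\<And>x. x \<in> U \<Longrightarrow> f x = g x"
  shows "smooth_euclid n U m f \<longleftrightarrow> smooth_euclid n U m g"
proof -
  have "C_on k n U (\<lambda>x. f x j) \<longleftrightarrow> C_on k n U (\<lambda>x. g x j)" for j k
    by (rule C_on_cong[OF assms(1)]) (simp add: assms(2))
  moreover have "f ` U = g ` U" using assms(2) by (rule image_cong[OF refl])
  ultimately show ?thesis unfolding smooth_euclid_def by simp
qed

lemma smooth_euclid_subset:
  "smooth_euclid n U m f \<Longrightarrow> V \<subseteq> U \<Longrightarrow> smooth_euclid n V m f"
  using C_on_subset[of _ n U _ V] by (fastforce simp: smooth_euclid_def)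

lemma smooth_euclid_local:
  assumes U: "openRn n U"
    and loc: "\<And>x. x \<in> U \<Longrightarrow> \<exists>V. openRn n V \<and> x \<in> V \<and> V \<subseteq> U \<and> smooth_euclid n V m f"
  shows "smooth_euclid n U m f"
  unfolding smooth_euclid_def
proof (intro conjI allI impI)
  show "f ` U \<subseteq> Rn m" using loc unfolding smooth_euclid_def by blast
  show "C_on k n U (\<lambda>x. f x j)" if "j < m" for j k
  proof (rule C_on_local[OF U])
    fix x assume "x \<in> U"
    then obtain V where "openRn n V" "x \<in> V" "V \<subseteq> U" "smooth_euclid n V m f" using loc by blast
    then show "\<exists>V. openRn n V \<and> x \<in> V \<and> V \<subseteq> U \<and> C_on k n V (\<lambda>x. f x j)"
      using that by (auto simp: smooth_euclid_def)
  qed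
qed

lemma smooth_euclid_const: "openRn n U \<Longrightarrow> c \<in> Rn m \<Longrightarrow> smooth_euclid n U m (\<lambda>x. c)"
  by (auto simp: smooth_euclid_def intro: C_on_const)

lemma smooth_euclid_continuous:
  assumes "openRn n U" "smooth_euclid n U m f"
  shows "continuous_on U f"
  using assms C_on_continuous[OF _ openRn_subset[OF assms(1)]]
  by (intro continuous_on_into_Rn[of m]) (auto simp: smooth_euclid_def)

lemma smooth_euclid_preimage:
  assumes "openRn n U" "smooth_euclid n U m f" "openRn m V"
  shows "openRn n {x\<in>U. f x \<in> V}"
proof -
  obtain T where T: "open T" "V = Rn m \<inter> T" using assms(3) openRn_iff by blast
  have "{x\<in>U. f x \<in> V} = {x\<in>U. f x \<in> T}" using T assms(2) by (auto simp: smooth_euclid_def)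
  then show ?thesis using openRn_preimage[OF assms(1) smooth_euclid_continuous[OF assms(1,2)] T(1)] by simp
qed

text \<open>The surjectivity clause of \<open>submersion\<close> in coordinates. The vectors are
  sequences of which only the first \<open>n\<close>, respectively \<open>m\<close>, entries
  count.\<close>

definition jac_onto :: "nat \<Rightarrow> nat \<Rightarrow> ((nat \<Rightarrow> real) \<Rightarrow> nat \<Rightarrow> real) \<Rightarrow> (nat \<Rightarrow> real) \<Rightarrow> bool" where
  "jac_onto n m F z \<longleftrightarrow> (\<forall>w. \<exists>v. \<forall>j<m. (\<Sum>i<n. pd i (\<lambda>x. F x j) z * v i) = w j)"

lemma pd_eq_coord:
  assumes "openRn n W" "z \<in> W" "i < n" "\<And>w. w \<in> W \<Longrightarrow> f w = w l"
  shows "pd i f z = (if i = l then 1 else 0)"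
  unfolding pd_def
proof (rule DERIV_imp_deriv, rule iffD2[OF DERIV_cong_ev])
  show "\<forall>\<^sub>F t in nhds (z i). f (z(i := t)) = (z(i := t)) l"
    using eventually_fun_upd[OF assms(1-3)] by eventually_elim (rule assms(4))
  show "((\<lambda>t. (z(i := t)) l) has_real_derivative (if i = l then 1 else 0)) (at (z i))"
    by (auto intro!: derivative_eq_intros)
qed auto

text \<open>The Jacobian of the substitution differs from the identity matrix in row
  \<open>i\<close> only, and its diagonal entry there is nonzero. It is therefore invertible, and
  multiplying the Jacobian of \<open>F\<close> by it preserves surjectivity.\<close>

lemma jac_onto_implicit:
  assumes W: "openRn n W" and W': "openRn n W'" and i: "i < n" and z': "z' \<in> W'"
    and F: "smooth_euclid n W m F" and h: "\<And>k. C_on k n W' h"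
    and into: "\<And>w. w \<in> W' \<Longrightarrow> w(i := h w) \<in> W"
    and nz: "pd i h z' \<noteq> 0" and onto: "jac_onto n m F (z'(i := h z'))"
  shows "jac_onto n m (\<lambda>w. F (w(i := h w))) z'"
  unfolding jac_onto_def
proof
  fix w
  define z where "z = z'(i := h z')"
  define D where "D j p = pd p (\<lambda>x. F x j) z" for j p
  \<comment> \<open>Row \<open>p\<close>, column \<open>l\<close> of the Jacobian of the
    substitution at \<open>z'\<close>.\<close>
  define E where "E p l = (if p = i then pd l h z' else if p = l then 1 else 0)" for p l
  have chain: "pd l (\<lambda>w. F (w(i := h w)) j) z' = (\<Sum>p<n. D j p * E p l)" if j: "j < m" and l: "l < n" for j l
  proof -
    have \<sigma>: "C_on (Suc 0) n W' (\<lambda>w. (w(i := h w)) p)" for p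
      using h[of "Suc 0"] C_on_coord[OF W', of "Suc 0" p] by (cases "p = i") (simp_all del: C_on.simps)
    have "((\<lambda>t. F ((z'(l := t))(i := h (z'(l := t)))) j) has_real_derivative
        (\<Sum>p<n. pd p (\<lambda>x. F x j) (z'(i := h z')) * pd l (\<lambda>w. (w(i := h w)) p) z')) (at (z' l))"
      by (rule C_on_chain[where g = "\<lambda>w. w(i := h w)" and f = "\<lambda>x. F x j", OF W W'])
        (use F j l z' into \<sigma> in \<open>auto simp: smooth_euclid_def simp del: C_on.simps fun_upd_apply\<close>)
    then have "pd l (\<lambda>w. F (w(i := h w)) j) z' =
        (\<Sum>p<n. D j p * pd l (\<lambda>w. (w(i := h w)) p) z')"
      unfolding pd_def[of l "\<lambda>w. F (w(i := h w)) j"] D_def z_def by (rule DERIV_imp_deriv)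
    also have "\<dots> = (\<Sum>p<n. D j p * E p l)"
    proof (rule sum.cong[OF refl])
      fix p
      show "D j p * pd l (\<lambda>w. (w(i := h w)) p) z' = D j p * E p l"
      proof (cases "p = i")
        case False
        then show ?thesis using pd_eq_coord[OF W' z' l, of _ p] by (auto simp: E_def)
      qed (simp add: E_def)
    qed
    finally show ?thesis .
  qed
  obtain v where v: "\<And>j. j < m \<Longrightarrow> (\<Sum>p<n. D j p * v p) = w j"
    using onto unfolding jac_onto_def D_def z_def by blast
  \<comment> \<open>The solution of \<open>E v' = v\<close>: every row but the \<open>i\<close>-th
    copies an entry, and the \<open>i\<close>-th equation is solved for \<open>v' i\<close>.\<close>
  define v' where "v' p = (if p = i then (v i - (\<Sum>l\<in>{..<n}-{i}. pd l h z' * v l)) / pd i h z' else v p)" for p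
  have Ev: "(\<Sum>l<n. E p l * v' l) = v p" if p: "p < n" for p
  proof (cases "p = i")
    case True
    have "(\<Sum>l<n. E p l * v' l) = pd i h z' * v' i + (\<Sum>l\<in>{..<n}-{i}. pd l h z' * v' l)"
      using True i by (subst sum.remove[of _ i]) (auto simp: E_def)
    also have "(\<Sum>l\<in>{..<n}-{i}. pd l h z' * v' l) = (\<Sum>l\<in>{..<n}-{i}. pd l h z' * v l)"
      by (intro sum.cong) (auto simp: v'_def)
    finally show ?thesis using nz True by (simp add: v'_def)
  next
    case False
    have "(\<Sum>l<n. E p l * v' l) = (\<Sum>l<n. if p = l then v p else 0)"
      using False by (intro sum.cong) (auto simp: E_def v'_def)
    then show ?thesis using p by (simp add: sum.delta)
  qed
  have "(\<Sum>l<n. pd l (\<lambda>w. F (w(i := h w)) j) z' * v' l) = w j" if j: "j < m" for j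
  proof -
    have "(\<Sum>l<n. pd l (\<lambda>w. F (w(i := h w)) j) z' * v' l) = (\<Sum>l<n. \<Sum>p<n. D j p * E p l * v' l)"
      using chain[OF j] by (auto simp: sum_distrib_right intro!: sum.cong)
    also have "\<dots> = (\<Sum>p<n. \<Sum>l<n. D j p * E p l * v' l)" by (rule sum.swap)
    also have "\<dots> = (\<Sum>p<n. D j p * (\<Sum>l<n. E p l * v' l))"
      by (simp add: sum_distrib_left mult.assoc)
    also have "\<dots> = (\<Sum>p<n. D j p * v p)" by (intro sum.cong) (auto simp: Ev)
    finally show ?thesis using v[OF j] by simp
  qed
  then show "\<exists>v. \<forall>j<m. (\<Sum>l<n. pd l (\<lambda>w. F (w(i := h w)) j) z' * v l) = w j" by blast
qed

text \<open>\<open>\<Psi>\<close> is a local reparametrisation of the source after which the first \<open>k\<close> components of \<open>F\<close>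
  are the coordinates \<open>\<iota> 0, \<dots>, \<iota> (k - 1)\<close>; each step solves one more component for one more coordinate.\<close>

lemma straighten_components:
  assumes U: "openRn n U" and F: "smooth_euclid n U m F" and x: "x \<in> U" and onto: "jac_onto n m F x"
    and "k \<le> m"
  shows "\<exists>W \<Psi> z \<iota>. openRn n W \<and> z \<in> W \<and> smooth_euclid n W n \<Psi> \<and> \<Psi> ` W \<subseteq> U \<and> \<Psi> z = x \<and>
    (\<forall>j<k. \<iota> j < n) \<and> inj_on \<iota> {..<k} \<and> (\<forall>w\<in>W. \<forall>j<k. F (\<Psi> w) j = w (\<iota> j)) \<and>
    jac_onto n m (\<lambda>w. F (\<Psi> w)) z"
  using \<open>k \<le> m\<close>
proof (induction k)
  case 0
  have "smooth_euclid n U n (\<lambda>w. w)"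
    using openRn_subset[OF U] by (auto simp: smooth_euclid_def intro: C_on_coord U)
  then show ?case
    using U x onto by (intro exI[of _ U] exI[of _ "\<lambda>w. w"] exI[of _ x] exI[of _ id]) auto
next
  case (Suc k)
  from Suc.IH[OF Suc_leD[OF Suc.prems]] obtain W \<Psi> z \<iota> where IH:
    "openRn n W \<and> z \<in> W \<and> smooth_euclid n W n \<Psi> \<and> \<Psi> ` W \<subseteq> U \<and> \<Psi> z = x \<and>
    (\<forall>j<k. \<iota> j < n) \<and> inj_on \<iota> {..<k} \<and> (\<forall>w\<in>W. \<forall>j<k. F (\<Psi> w) j = w (\<iota> j)) \<and>
    jac_onto n m (\<lambda>w. F (\<Psi> w)) z"
    by (elim exE)
  have W: "openRn n W" "z \<in> W" and \<Psi>: "smooth_euclid n W n \<Psi>" "\<Psi> ` W \<subseteq> U" "\<Psi> z = x"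
    and \<iota>: "\<And>j. j < k \<Longrightarrow> \<iota> j < n" "inj_on \<iota> {..<k}"
      "\<And>w j. w \<in> W \<Longrightarrow> j < k \<Longrightarrow> F (\<Psi> w) j = w (\<iota> j)"
    and onto: "jac_onto n m (\<lambda>w. F (\<Psi> w)) z"
    using IH by simp_all
  have G: "smooth_euclid n W m (\<lambda>w. F (\<Psi> w))" by (rule smooth_euclid_compose[OF U W(1) F \<Psi>(1,2)])
  have k: "k < m" using Suc.prems by simp
  \<comment> \<open>Choice of the next coordinate. The Jacobian sends \<open>v\<close> to the
    \<open>k\<close>-th unit vector. Each row \<open>j < k\<close> merely reads off the coordinate
    \<open>\<iota> j\<close>, so \<open>v\<close> vanishes there. Row \<open>k\<close> pairs to 1
    with \<open>v\<close>, so some \<open>i\<close> has a nonzero entry and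
    \<open>v i \<noteq> 0\<close>; such an \<open>i\<close> is none of the coordinates already
    used.\<close>
  obtain v where v: "\<And>j. j < m \<Longrightarrow> (\<Sum>i<n. pd i (\<lambda>w. F (\<Psi> w) j) z * v i) = (if j = k then 1 else 0)"
    using onto[unfolded jac_onto_def, THEN spec, of "\<lambda>j. if j = k then 1 else 0"] by blast
  have v0: "v (\<iota> j) = 0" if j: "j < k" for j
  proof -
    have "(\<Sum>i<n. pd i (\<lambda>w. F (\<Psi> w) j) z * v i) = (\<Sum>i<n. if i = \<iota> j then v (\<iota> j) else 0)"
      by (intro sum.cong) (auto simp: pd_eq_coord[OF W _ \<iota>(3)[OF _ j]])
    then show ?thesis using v[of j] j k \<iota>(1)[OF j] by (simp add: sum.delta)
  qed
  obtain i where i: "i < n" and "pd i (\<lambda>w. F (\<Psi> w) k) z * v i \<noteq> 0"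
    using v[OF k] sum.neutral[of "{..<n}" "\<lambda>i. pd i (\<lambda>w. F (\<Psi> w) k) z * v i"] by fastforce
  then have nz: "pd i (\<lambda>w. F (\<Psi> w) k) z \<noteq> 0" and i\<iota>: "\<And>j. j < k \<Longrightarrow> \<iota> j \<noteq> i" using v0 by auto
  \<comment> \<open>The base point that the new substitution carries to \<open>z\<close>.\<close>
  define z' where "z' = z(i := F (\<Psi> z) k)"
  obtain W' h where W': "openRn n W'" "z' \<in> W'" and hz: "h z' = z i" and h: "\<And>k. C_on k n W' h"
    "\<And>w. w \<in> W' \<Longrightarrow> w(i := h w) \<in> W" "\<And>w. w \<in> W' \<Longrightarrow> F (\<Psi> (w(i := h w))) k = w i"
    "\<And>w. w \<in> W' \<Longrightarrow> pd i h w \<noteq> 0"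
    unfolding z'_def
    by (rule implicit_coordinate[OF W(1) _ i W(2) nz]) (use G k in \<open>auto simp: smooth_euclid_def intro: that\<close>)
  have z'z: "z'(i := h z') = z" unfolding hz by (simp add: z'_def)
  have "jac_onto n m (\<lambda>w. F (\<Psi> (w(i := h w)))) z'"
    by (rule jac_onto_implicit[OF W(1) W'(1) i W'(2) G h(1,2) h(4)[OF W'(2)]]) (simp_all only: z'z onto)
  moreover have "smooth_euclid n W' n (\<lambda>w. \<Psi> (w(i := h w)))"
  proof (rule smooth_euclid_compose[OF W(1) W'(1) \<Psi>(1)])
    show "smooth_euclid n W' n (\<lambda>w. w(i := h w))"
      unfolding smooth_euclid_def
    proof (intro conjI allI impI)
      show "(\<lambda>w. w(i := h w)) ` W' \<subseteq> Rn n" using h(2) openRn_subset[OF W(1)] by blast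
      show "C_on k n W' (\<lambda>w. (w(i := h w)) j)" for j k
        by (cases "j = i") (simp_all add: h(1) C_on_coord[OF W'(1)])
    qed
  qed (use h(2) in blast)
  moreover have "(\<lambda>w. \<Psi> (w(i := h w))) ` W' \<subseteq> U" using h(2) \<Psi>(2) by blast
  moreover have "inj_on (\<iota>(k := i)) {..<Suc k}"
    using \<iota>(2) i\<iota> unfolding lessThan_Suc by (force simp: inj_on_def)
  \<comment> \<open>The substitution alters coordinate \<open>i\<close> alone, so the components
    already straightened stay so.\<close>
  moreover have "F (\<Psi> (w(i := h w))) j = w ((\<iota>(k := i)) j)" if "w \<in> W'" "j < Suc k" for w j
    using that h(2,3) \<iota>(3)[of "w(i := h w)" j] i\<iota> by (cases "j = k") auto
  ultimately show ?case
    using W' z'z \<Psi>(3) \<iota>(1) i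
    by (intro exI[of _ W'] exI[of _ "\<lambda>w. \<Psi> (w(i := h w))"] exI[of _ z'] exI[of _ "\<iota>(k := i)"])
      (auto simp: less_Suc_eq simp del: fun_upd_apply simp: fun_upd_same fun_upd_other)
qed

text \<open>Once all \<open>m\<close> components are straightened, \<open>F\<close> after
  \<open>\<Psi>\<close> is a coordinate projection. Its section \<open>T\<close> inserts
  \<open>y\<close> at the coordinates \<open>\<iota> j\<close> and freezes the others at their
  values in \<open>z\<close>; then \<open>\<Psi>\<close> is applied.\<close>

lemma local_section:
  assumes U: "openRn n U" and F: "smooth_euclid n U m F" and x: "x \<in> U" and onto: "jac_onto n m F x"
  obtains Y s where "openRn m Y" "F x \<in> Y" "smooth_euclid m Y n s" "s ` Y \<subseteq> U"
    "\<And>y. y \<in> Y \<Longrightarrow> F (s y) = y"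
proof -
  obtain W \<Psi> z \<iota> where W: "openRn n W" "z \<in> W" and \<Psi>: "smooth_euclid n W n \<Psi>" "\<Psi> ` W \<subseteq> U" "\<Psi> z = x"
    and \<iota>: "\<And>j. j < m \<Longrightarrow> \<iota> j < n" "inj_on \<iota> {..<m}"
      "\<And>w j. w \<in> W \<Longrightarrow> j < m \<Longrightarrow> F (\<Psi> w) j = w (\<iota> j)"
    using straighten_components[OF assms order_refl] by blast
  have zR: "z \<in> Rn n" using W openRn_subset by blast
  have R: "openRn m (Rn m)" by simp
  define T where "T y i = (if i \<in> \<iota> ` {..<m} then y (inv_into {..<m} \<iota> i) else z i)" for y :: "nat \<Rightarrow> real" and i
  have T\<iota>: "T y (\<iota> j) = y j" if "j < m" for y j
    using that inv_into_f_f[OF \<iota>(2)] by (auto simp: T_def)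
  have T: "smooth_euclid m (Rn m) n T"
    unfolding smooth_euclid_def
  proof (intro conjI allI impI)
    show "T ` Rn m \<subseteq> Rn n" using zR \<iota>(1) by (force simp: T_def topspace_Euclidean_space)
    show "C_on k m (Rn m) (\<lambda>y. T y i)" for i k
      by (cases "i \<in> \<iota> ` {..<m}") (simp_all add: T_def C_on_coord C_on_const R)
  qed
  define Y where "Y = {y\<in>Rn m. T y \<in> W}"
  have Y: "openRn m Y" unfolding Y_def by (rule smooth_euclid_preimage[OF R T W(1)])
  have FR: "F u \<in> Rn m" if "u \<in> U" for u using F that by (auto simp: smooth_euclid_def)
  show ?thesis
  proof (rule that[OF Y])
    have "T (F x) i = z i" for i
      using T\<iota>[of _ "F x"] \<iota>(3)[OF W(2)] \<Psi>(3) by (cases "i \<in> \<iota> ` {..<m}") (auto simp: T_def)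
    then have "T (F x) = z" by blast
    then show "F x \<in> Y" using FR[OF x] W(2) by (simp add: Y_def)
    show "smooth_euclid m Y n (\<lambda>y. \<Psi> (T y))"
      by (rule smooth_euclid_compose[OF W(1) Y \<Psi>(1) smooth_euclid_subset[OF T]]) (auto simp: Y_def)
    show into: "(\<lambda>y. \<Psi> (T y)) ` Y \<subseteq> U" using \<Psi>(2) by (auto simp: Y_def)
    show "F (\<Psi> (T y)) = y" if y: "y \<in> Y" for y
    proof
      fix j
      show "F (\<Psi> (T y)) j = y j"
      proof (cases "j < m")
        case True
        then show ?thesis using \<iota>(3) T\<iota> y by (simp add: Y_def)
      next
        case False
        moreover have "F (\<Psi> (T y)) \<in> Rn m" using FR into y by blast
        moreover have "y \<in> Rn m" using y by (simp add: Y_def)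
        ultimately show ?thesis by (simp add: topspace_Euclidean_space)
      qed
    qed
  qed
qed

section \<open>Plots of manifolds and of quotients\<close>

lemma smooth_euclid_continuous_map:
  assumes "openRn m V" "openRn n U" "smooth_euclid m V n f" "f ` V \<subseteq> U"
  shows "continuous_map (subtopology (Euclidean_space m) V) (subtopology (Euclidean_space n) U) f"
proof -
  have "subtopology (Euclidean_space k) S = top_of_set S" if "openRn k S" for k S
    using openRn_subset[OF that]
    by (subst Euclidean_space_top_of_set) (simp add: subtopology_subtopology inf.absorb2)
  then show ?thesis
    using assms smooth_euclid_continuous[OF assms(1,3)] by (simp add: image_subset_iff_funcset)
qed

lemma smooth_manifold_chart:
  assumes "smooth_manifold M" "(n, V, \<phi>) \<in> atlas M"
  shows "openin (mtop M) V" "V \<subseteq> pts M" "openRn n (\<phi> ` V)" "inj_on \<phi> V"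
    "continuous_map (subtopology (Euclidean_space n) (\<phi> ` V)) (mtop M) (inv_into V \<phi>)"
proof -
  have h: "homeomorphic_map (subtopology (mtop M) V) (subtopology (Euclidean_space n) (\<phi> ` V)) \<phi>"
    using assms unfolding smooth_manifold_def by blast
  show o: "openin (mtop M) V" and "openRn n (\<phi> ` V)"
    using assms unfolding smooth_manifold_def by blast+
  show V: "V \<subseteq> pts M" using o by (rule openin_subset)
  have top: "topspace (subtopology (mtop M) V) = V" using V by auto
  show inj: "inj_on \<phi> V" using homeomorphic_imp_injective_map[OF h] top by simp
  from h obtain g where g: "homeomorphic_maps (subtopology (mtop M) V) (subtopology (Euclidean_space n) (\<phi> ` V)) \<phi> g"
    using homeomorphic_map_maps by blast
  then have "continuous_map (subtopology (Euclidean_space n) (\<phi> ` V)) (subtopology (mtop M) V) g"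
    and gf: "\<And>x. x \<in> V \<Longrightarrow> g (\<phi> x) = x"
    using top by (auto simp: homeomorphic_maps_def)
  then have "continuous_map (subtopology (Euclidean_space n) (\<phi> ` V)) (mtop M) g"
    using continuous_map_in_subtopology by blast
  then show "continuous_map (subtopology (Euclidean_space n) (\<phi> ` V)) (mtop M) (inv_into V \<phi>)"
    by (rule continuous_map_eq) (use gf inj in \<open>auto simp: inv_into_f_f\<close>)
qed

lemma smooth_manifold_covered:
  assumes "smooth_manifold M" "x \<in> pts M"
  obtains n V \<phi> where "(n, V, \<phi>) \<in> atlas M" "x \<in> V"
  using assms unfolding smooth_manifold_def by blast

lemma smooth_map_continuous: "smooth_map M N f \<Longrightarrow> continuous_map (mtop M) (mtop N) f"
  by (simp add: smooth_map_def)

lemma smooth_map_pts: "smooth_map M N f \<Longrightarrow> x \<in> pts M \<Longrightarrow> f x \<in> pts N"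
  using smooth_map_continuous continuous_map_image_subset_topspace by blast

lemma openRn_preimage_map:
  assumes "openRn n U" "continuous_map (subtopology (Euclidean_space n) U) X p" "openin X W"
  shows "openRn n {x\<in>U. p x \<in> W}"
proof -
  have "openin (subtopology (Euclidean_space n) U) {x \<in> topspace (subtopology (Euclidean_space n) U). p x \<in> W}"
    by (rule openin_continuous_map_preimage[OF assms(2,3)])
  moreover have "topspace (subtopology (Euclidean_space n) U) = U"
    using openRn_subset[OF assms(1)] by auto
  ultimately show ?thesis using openin_trans_full[OF _ assms(1)] by fastforce
qed

text \<open>The chart of \<open>euclid n U\<close> is the identity, but its inverse
  \<open>inv_into U id\<close> is the identity on \<open>U\<close> only. Removing it relies on
  congruence over open sets, hence on openness of the preimages of chart domains.\<close>

lemma smooth_map_euclid_iff: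
  assumes "smooth_manifold M" "openRn n U"
  shows "smooth_map (euclid n U) M p \<longleftrightarrow>
    continuous_map (subtopology (Euclidean_space n) U) (mtop M) p \<and>
    (\<forall>(m, W, \<psi>)\<in>atlas M. smooth_euclid n {x\<in>U. p x \<in> W} m (\<lambda>x. \<psi> (p x)))"
proof (cases "continuous_map (subtopology (Euclidean_space n) U) (mtop M) p")
  case True
  have "smooth_euclid n {x\<in>U. p x \<in> W} m (local_rep U id p \<psi>) \<longleftrightarrow>
      smooth_euclid n {x\<in>U. p x \<in> W} m (\<lambda>x. \<psi> (p x))" if "(m, W, \<psi>) \<in> atlas M" for m W \<psi>
  proof (rule smooth_euclid_cong)
    show "openRn n {x\<in>U. p x \<in> W}"
      by (rule openRn_preimage_map[OF assms(2) True smooth_manifold_chart(1)[OF assms(1) that]])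
    show "local_rep U id p \<psi> x = \<psi> (p x)" if "x \<in> {x\<in>U. p x \<in> W}" for x
      using inv_into_f_f[of id U x] that by (simp add: local_rep_def)
  qed
  then show ?thesis using True by (auto simp: smooth_map_def euclid_def)
next
  case False
  then show ?thesis by (simp add: smooth_map_def euclid_def)
qed

lemma smooth_map_euclidD:
  assumes "smooth_manifold M" "openRn n U" "smooth_map (euclid n U) M p"
  shows "continuous_map (subtopology (Euclidean_space n) U) (mtop M) p"
    and "(m, W, \<psi>) \<in> atlas M \<Longrightarrow> smooth_euclid n {x\<in>U. p x \<in> W} m (\<lambda>x. \<psi> (p x))"
  using smooth_map_euclid_iff[OF assms(1,2)] assms(3) by (simp, blast)

text \<open>Meant for a lift \<open>c\<close> written in one chart of \<open>M\<close>, followed by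
  an anchor \<open>f\<close>. In charts of \<open>N\<close> the result is a local representative of
  \<open>f\<close> after \<open>c\<close>, a composite of smooth Euclidean maps.\<close>

lemma smooth_map_chart_param:
  assumes M: "smooth_manifold M" and N: "smooth_manifold N" and f: "smooth_map M N f"
    and V: "(m, V, \<phi>) \<in> atlas M" and U: "openRn n U" and c: "smooth_euclid n U m c" "c ` U \<subseteq> \<phi> ` V"
  shows "smooth_map (euclid n U) N (\<lambda>x. f (inv_into V \<phi> (c x)))"
proof -
  note ch = smooth_manifold_chart[OF M V]
  note cont_c = smooth_euclid_continuous_map[OF U ch(3) c]
  have cont: "continuous_map (subtopology (Euclidean_space n) U) (mtop N) (\<lambda>x. f (inv_into V \<phi> (c x)))"
    using continuous_map_compose[OF continuous_map_compose[OF cont_c ch(5)] smooth_map_continuous[OF f]]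
    by (simp add: o_def)
  have "smooth_euclid n {x\<in>U. f (inv_into V \<phi> (c x)) \<in> W} k (\<lambda>x. \<psi> (f (inv_into V \<phi> (c x))))"
    if W: "(k, W, \<psi>) \<in> atlas N" for k W \<psi>
  proof -
    let ?D = "\<phi> ` {x\<in>V. f x \<in> W}"
    have rep: "smooth_euclid m ?D k (local_rep V \<phi> f \<psi>)" using f V W unfolding smooth_map_def by blast
    have D: "openRn m ?D"
    proof -
      have "?D = {y\<in>\<phi> ` V. f (inv_into V \<phi> y) \<in> W}"
        using ch(4) by (auto simp: inv_into_f_f)
      moreover have "openRn m {y\<in>\<phi> ` V. f (inv_into V \<phi> y) \<in> W}"
        using openRn_preimage_map[OF ch(3) _ smooth_manifold_chart(1)[OF N W]]
          continuous_map_compose[OF ch(5) smooth_map_continuous[OF f]] by (simp add: o_def)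
      ultimately show ?thesis by simp
    qed
    have U': "openRn n {x\<in>U. f (inv_into V \<phi> (c x)) \<in> W}"
      by (rule openRn_preimage_map[OF U cont smooth_manifold_chart(1)[OF N W]])
    have "smooth_euclid n {x\<in>U. f (inv_into V \<phi> (c x)) \<in> W} k (\<lambda>x. local_rep V \<phi> f \<psi> (c x))"
    proof (rule smooth_euclid_compose[OF D U' rep])
      show "smooth_euclid n {x\<in>U. f (inv_into V \<phi> (c x)) \<in> W} m c"
        by (rule smooth_euclid_subset[OF c(1)]) auto
      show "c ` {x\<in>U. f (inv_into V \<phi> (c x)) \<in> W} \<subseteq> ?D"
        using c(2) ch(4) by (force simp: inv_into_f_f)
    qed
    then show ?thesis by (simp add: local_rep_def o_def)
  qed
  then show ?thesis using cont by (auto simp: smooth_map_euclid_iff[OF N U])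
qed

section \<open>The diffeology axioms for manifolds and quotients\<close>

lemma diffeological_space_manifold:
  assumes M: "smooth_manifold M"
  shows "diffeological_space (manifold_diffeology M)"
proof -
  have plots: "(n, U, p) \<in> plots (manifold_diffeology M) \<longleftrightarrow>
      openRn n U \<and> p \<in> U \<rightarrow>\<^sub>E pts M \<and> smooth_map (euclid n U) M p" for n U p
    by (auto simp: manifold_diffeology_def parametrisations_def)
  have const: "smooth_map (euclid n U) M (\<lambda>u\<in>U. x)" if U: "openRn n U" and x: "x \<in> pts M" for n U x
    unfolding smooth_map_euclid_iff[OF M U]
  proof (intro conjI ballI, goal_cases)
    case 1
    show ?case by (rule continuous_map_eq[of _ _ "\<lambda>_. x"]) (use x in auto)
  next
    case (2 a)
    obtain m W \<psi> where a: "a = (m, W, \<psi>)" by (cases a)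
    show ?case
    proof (cases "x \<in> W")
      case True
      then have "\<psi> x \<in> Rn m" using smooth_manifold_chart(3)[OF M] 2 a openRn_subset by blast
      then have "smooth_euclid n U m (\<lambda>_. \<psi> x)" by (rule smooth_euclid_const[OF U])
      moreover have "{u\<in>U. (\<lambda>u\<in>U. x) u \<in> W} = U" using True by auto
      ultimately show ?thesis unfolding a prod.case
        using smooth_euclid_cong[OF U, of "\<lambda>u. \<psi> ((\<lambda>u\<in>U. x) u)" "\<lambda>_. \<psi> x"] by simp
    next
      case False
      \<comment> \<open>A chart that misses the constant value imposes a condition on the empty set
        only.\<close>
      then have "{u\<in>U. (\<lambda>u\<in>U. x) u \<in> W} = {}" by auto
      then show ?thesis unfolding a prod.case by (metis smooth_euclid_local empty_iff openin_empty)
    qed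
  qed
  have local: "smooth_map (euclid n U) M p"
    if U: "openRn n U" and un: "\<Union>\<U> = U"
      and pl: "\<And>V. V \<in> \<U> \<Longrightarrow> openRn n V \<and> smooth_map (euclid n V) M (restrict p V)" for n U p \<U>
  proof -
    have contV: "continuous_map (subtopology (Euclidean_space n) V) (mtop M) p" if "V \<in> \<U>" for V
    proof (rule continuous_map_eq)
      show "continuous_map (subtopology (Euclidean_space n) V) (mtop M) (restrict p V)"
        using smooth_map_euclidD(1)[OF M conjunct1[OF pl[OF that]] conjunct2[OF pl[OF that]]] .
    qed auto
    have cont: "continuous_map (subtopology (Euclidean_space n) U) (mtop M) p"
    proof (rule pasting_lemma[where I = \<U> and T = "\<lambda>V. V" and f = "\<lambda>_. p"])
      show "continuous_map (subtopology (subtopology (Euclidean_space n) U) V) (mtop M) p" if "V \<in> \<U>" for V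
      proof -
        have "U \<inter> V = V" using un that by blast
        then show ?thesis using contV[OF that] by (simp add: subtopology_subtopology)
      qed
      show "openin (subtopology (Euclidean_space n) U) V" if "V \<in> \<U>" for V
        using pl[OF that] un that by (auto simp: openin_open_subtopology U)
    qed (use un in auto)
    have "smooth_euclid n {x\<in>U. p x \<in> W} m (\<lambda>x. \<psi> (p x))" if W: "(m, W, \<psi>) \<in> atlas M" for m W \<psi>
    proof (rule smooth_euclid_local)
      show "openRn n {x\<in>U. p x \<in> W}"
        by (rule openRn_preimage_map[OF U cont smooth_manifold_chart(1)[OF M W]])
      fix x assume "x \<in> {x\<in>U. p x \<in> W}"
      then obtain V where V: "V \<in> \<U>" "x \<in> V" "p x \<in> W" using un by blast
      have o: "openRn n {x\<in>V. p x \<in> W}"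
        using openRn_preimage_map[OF _ contV[OF V(1)] smooth_manifold_chart(1)[OF M W]] pl[OF V(1)] by blast
      have "smooth_euclid n {x\<in>V. restrict p V x \<in> W} m (\<lambda>x. \<psi> (restrict p V x))"
        using smooth_map_euclidD(2)[OF M conjunct1[OF pl[OF V(1)]] conjunct2[OF pl[OF V(1)]] W] .
      moreover have "{x\<in>V. restrict p V x \<in> W} = {x\<in>V. p x \<in> W}" by auto
      ultimately have "smooth_euclid n {x\<in>V. p x \<in> W} m (\<lambda>x. \<psi> (p x))"
        using smooth_euclid_cong[OF o, of "\<lambda>x. \<psi> (restrict p V x)" "\<lambda>x. \<psi> (p x)"] by simp
      then show "\<exists>V. openRn n V \<and> x \<in> V \<and> V \<subseteq> {x\<in>U. p x \<in> W} \<and> smooth_euclid n V m (\<lambda>x. \<psi> (p x))"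
        using o V un by (intro exI[of _ "{x\<in>V. p x \<in> W}"]) auto
    qed
    then show ?thesis using cont by (auto simp: smooth_map_euclid_iff[OF M U])
  qed
  have comp: "smooth_map (euclid m V) M (compose V p f)"
    if U: "openRn n U" and p: "smooth_map (euclid n U) M p"
      and V: "openRn m V" and f: "smooth_euclid m V n f" "f ` V \<subseteq> U" for n U p m V f
  proof -
    have cp: "continuous_map (subtopology (Euclidean_space n) U) (mtop M) p"
      by (rule smooth_map_euclidD(1)[OF M U p])
    from continuous_map_compose[OF smooth_euclid_continuous_map[OF V U f] cp]
    have cont: "continuous_map (subtopology (Euclidean_space m) V) (mtop M) (compose V p f)"
      by (rule continuous_map_eq) (auto simp: compose_def)
    have "smooth_euclid m {x\<in>V. compose V p f x \<in> W} k (\<lambda>x. \<psi> (compose V p f x))"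
      if W: "(k, W, \<psi>) \<in> atlas M" for k W \<psi>
    proof -
      note oW = smooth_manifold_chart(1)[OF M W]
      have o: "openRn m {x\<in>V. compose V p f x \<in> W}" by (rule openRn_preimage_map[OF V cont oW])
      have "smooth_euclid m {x\<in>V. compose V p f x \<in> W} k (\<lambda>x. \<psi> (p (f x)))"
      proof (rule smooth_euclid_compose[OF openRn_preimage_map[OF U cp oW] o smooth_map_euclidD(2)[OF M U p W]])
        show "smooth_euclid m {x\<in>V. compose V p f x \<in> W} n f"
          by (rule smooth_euclid_subset[OF f(1)]) auto
        show "f ` {x\<in>V. compose V p f x \<in> W} \<subseteq> {x\<in>U. p x \<in> W}"
          using f(2) by (auto simp: compose_def)
      qed
      then show ?thesis
        using smooth_euclid_cong[OF o, of "\<lambda>x. \<psi> (p (f x))" "\<lambda>x. \<psi> (compose V p f x)"] by (simp add: compose_def)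
    qed
    then show ?thesis using cont by (auto simp: smooth_map_euclid_iff[OF M V])
  qed
  show ?thesis
    unfolding diffeological_space_def
  proof (intro conjI)
    show "plots (manifold_diffeology M) \<subseteq> parametrisations (points (manifold_diffeology M))"
      by (auto simp: manifold_diffeology_def)
    have pt: "points (manifold_diffeology M) = pts M" by (simp add: manifold_diffeology_def)
    show "\<forall>n U. \<forall>x\<in>points (manifold_diffeology M). openRn n U \<longrightarrow> (n, U, \<lambda>u\<in>U. x) \<in> plots (manifold_diffeology M)"
      using const by (auto simp: plots pt)
    show "\<forall>(n, U, p)\<in>parametrisations (points (manifold_diffeology M)).
       (\<exists>\<U>. \<Union> \<U> = U \<and> (\<forall>V\<in>\<U>. openRn n V \<and> (n, V, restrict p V) \<in> plots (manifold_diffeology M))) \<longrightarrow>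
       (n, U, p) \<in> plots (manifold_diffeology M)"
    proof (intro ballI, clarify)
      fix n p \<U>
      assume p: "(n, \<Union>\<U>, p) \<in> parametrisations (points (manifold_diffeology M))"
        and pl: "\<forall>V\<in>\<U>. openRn n V \<and> (n, V, restrict p V) \<in> plots (manifold_diffeology M)"
      have U: "openRn n (\<Union>\<U>)" using p by (simp add: parametrisations_def)
      show "(n, \<Union>\<U>, p) \<in> plots (manifold_diffeology M)"
        using local[OF U refl] p pl by (simp add: plots pt parametrisations_def)
    qed
    show "\<forall>(n, U, p)\<in>plots (manifold_diffeology M). \<forall>m V f.
       openRn m V \<and> smooth_euclid m V n f \<and> f ` V \<subseteq> U \<longrightarrow> (m, V, compose V p f) \<in> plots (manifold_diffeology M)"
      using comp by (auto simp: plots compose_def PiE_iff image_subset_iff)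
  qed
qed

text \<open>Locality is built in, since plots of the quotient are described by local lifts.
  Constants lift to constants of \<open>X\<close>, and a composite with a smooth map is lifted by
  composing the lifts.\<close>

lemma diffeological_space_quotient:
  assumes X: "diffeological_space X"
  shows "diffeological_space (quotient_diffeology X R)"
proof -
  let ?Q = "quotient_diffeology X R"
  have pt: "points ?Q = points X // R" by (simp add: quotient_diffeology_def)
  have plots: "(n, U, p) \<in> plots ?Q \<longleftrightarrow> openRn n U \<and> p \<in> U \<rightarrow>\<^sub>E points X // R \<and>
      (\<forall>u\<in>U. \<exists>V q. openRn n V \<and> u \<in> V \<and> V \<subseteq> U \<and> (n, V, q) \<in> plots X \<and> (\<forall>v\<in>V. p v = R `` {q v}))" for n U p
    by (auto simp: quotient_diffeology_def parametrisations_def)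
  have const: "(n, U, \<lambda>u\<in>U. c) \<in> plots ?Q" if c: "c \<in> points X // R" and U: "openRn n U" for n U c
  proof -
    obtain x where x: "x \<in> points X" "c = R `` {x}" using c by (rule quotientE)
    have "(n, U, \<lambda>u\<in>U. x) \<in> plots X" 
      using X[unfolded diffeological_space_def, THEN conjunct2, THEN conjunct1] x(1) U by blast
    then show ?thesis unfolding plots using U c x(2) by fastforce
  qed
  have local: "(n, U, p) \<in> plots ?Q"
    if p: "openRn n U" "p \<in> U \<rightarrow>\<^sub>E points X // R" and un: "\<Union>\<U> = U"
      and pl: "\<And>V. V \<in> \<U> \<Longrightarrow> (n, V, restrict p V) \<in> plots ?Q" for n U p \<U>
    unfolding plots
  proof (intro conjI p ballI)
    fix u assume "u \<in> U"
    then obtain V where V: "V \<in> \<U>" "u \<in> V" using un by blast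
    then obtain V' q where V': "openRn n V'" "u \<in> V'" "V' \<subseteq> V" "(n, V', q) \<in> plots X"
      "\<forall>v\<in>V'. restrict p V v = R `` {q v}"
      using pl[OF V(1)] unfolding plots by blast
    have "p v = R `` {q v}" if "v \<in> V'" for v
      using V'(3,5) that by (metis restrict_apply' subsetD)
    with V'(1-4) show "\<exists>V q. openRn n V \<and> u \<in> V \<and> V \<subseteq> U \<and> (n, V, q) \<in> plots X \<and> (\<forall>v\<in>V. p v = R `` {q v})"
      using V un by (intro exI[of _ V'] exI[of _ q]) auto
  qed
  have comp: "(m, V, compose V p f) \<in> plots ?Q"
    if p: "(n, U, p) \<in> plots ?Q" and V: "openRn m V" and f: "smooth_euclid m V n f" "f ` V \<subseteq> U" for n U p m V f
    unfolding plots
  proof (intro conjI V ballI)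
    show "compose V p f \<in> V \<rightarrow>\<^sub>E points X // R"
      using p f(2) unfolding plots by (auto simp: compose_def PiE_iff)
    fix v assume v: "v \<in> V"
    then obtain U' q where q: "openRn n U'" "f v \<in> U'" "U' \<subseteq> U" "(n, U', q) \<in> plots X"
      "\<And>u. u\<in>U' \<Longrightarrow> p u = R `` {q u}"
      using p f(2) unfolding plots by (metis image_subset_iff)
    define V' where "V' = {x\<in>V. f x \<in> U'}"
    have V': "openRn m V'" unfolding V'_def by (rule smooth_euclid_preimage[OF V f(1) q(1)])
    have "\<forall>(n, U, p)\<in>plots X. \<forall>m V f. openRn m V \<and> smooth_euclid m V n f \<and> f ` V \<subseteq> U \<longrightarrow>
        (m, V, compose V p f) \<in> plots X"
      by (rule X[unfolded diffeological_space_def, THEN conjunct2, THEN conjunct2, THEN conjunct2])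
    moreover have "smooth_euclid m V' n f" by (rule smooth_euclid_subset[OF f(1)]) (auto simp: V'_def)
    moreover have "f ` V' \<subseteq> U'" by (auto simp: V'_def)
    ultimately have "(m, V', compose V' q f) \<in> plots X" using q(4) V' by blast
    moreover have "compose V p f x = R `` {compose V' q f x}" if "x \<in> V'" for x
      using that q(5) by (simp add: compose_def V'_def)
    ultimately show "\<exists>V' q. openRn m V' \<and> v \<in> V' \<and> V' \<subseteq> V \<and> (m, V', q) \<in> plots X \<and>
        (\<forall>x\<in>V'. compose V p f x = R `` {q x})"
      using V' v q(2) by (intro exI[of _ V'] exI[of _ "compose V' q f"]) (auto simp: V'_def)
  qed
  show ?thesis
    unfolding diffeological_space_def
  proof (intro conjI)
    show "plots ?Q \<subseteq> parametrisations (points ?Q)" by (auto simp: quotient_diffeology_def)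
    show "\<forall>n U. \<forall>x\<in>points ?Q. openRn n U \<longrightarrow> (n, U, \<lambda>u\<in>U. x) \<in> plots ?Q"
      using const unfolding pt by blast
    show "\<forall>(n, U, p)\<in>parametrisations (points ?Q).
       (\<exists>\<U>. \<Union> \<U> = U \<and> (\<forall>V\<in>\<U>. openRn n V \<and> (n, V, restrict p V) \<in> plots ?Q)) \<longrightarrow> (n, U, p) \<in> plots ?Q"
    proof (intro ballI, clarify)
      fix n p \<U>
      assume p: "(n, \<Union>\<U>, p) \<in> parametrisations (points ?Q)"
        and pl: "\<forall>V\<in>\<U>. openRn n V \<and> (n, V, restrict p V) \<in> plots ?Q"
      show "(n, \<Union>\<U>, p) \<in> plots ?Q"
        by (rule local[OF _ _ refl]) (use p pl in \<open>auto simp: pt parametrisations_def\<close>)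
    qed
    show "\<forall>(n, U, p)\<in>plots ?Q. \<forall>m V f.
       openRn m V \<and> smooth_euclid m V n f \<and> f ` V \<subseteq> U \<longrightarrow> (m, V, compose V p f) \<in> plots ?Q"
      using comp by blast
  qed
qed

section \<open>Bibundles and orbit spaces\<close>

text \<open>Permits replacing a lift by its \<open>restrict\<close>, as plots must be
  \<open>undefined\<close> off their domain.\<close>

lemma smooth_map_euclid_cong:
  assumes M: "smooth_manifold M" and U: "openRn n U" and eq: "\<And>x. x \<in> U \<Longrightarrow> f x = g x"
    and f: "smooth_map (euclid n U) M g"
  shows "smooth_map (euclid n U) M f"
  unfolding smooth_map_euclid_iff[OF M U]
proof (intro conjI ballI, goal_cases)
  case 1
  show ?case by (rule continuous_map_eq[OF smooth_map_euclidD(1)[OF M U f]]) (simp add: eq)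
next
  case (2 a)
  obtain m W \<psi> where a: "a = (m, W, \<psi>)" by (cases a)
  have W: "(m, W, \<psi>) \<in> atlas M" using 2 a by simp
  have "{x\<in>U. g x \<in> W} = {x\<in>U. f x \<in> W}" using eq by auto
  moreover have "smooth_euclid n {x\<in>U. g x \<in> W} m (\<lambda>x. \<psi> (f x)) \<longleftrightarrow>
      smooth_euclid n {x\<in>U. g x \<in> W} m (\<lambda>x. \<psi> (g x))"
    by (rule smooth_euclid_cong[OF openRn_preimage_map[OF U smooth_map_euclidD(1)[OF M U f]
          smooth_manifold_chart(1)[OF M W]]]) (simp add: eq)
  ultimately show ?case using smooth_map_euclidD(2)[OF M U f W] unfolding a by simp
qed

lemma pts_fibre_product:
  "pts (fibre_product M N f g) = {(x, y). x \<in> pts M \<and> y \<in> pts N \<and> f x = g y}"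
  by (auto simp: fibre_product_def submanifold_def prod_manifold_def)

text \<open>\<open>topology\<close> returns the intended open sets only for predicates satisfying
  \<open>istopology\<close>, so this is checked before the points are read off. The whole image is
  then open because its preimage is everything.\<close>

lemma pts_quotient_manifold: "pts (quotient_manifold M q) = q ` pts M"
proof -
  let ?P = "\<lambda>U. U \<subseteq> q ` pts M \<and> openin (mtop M) {x\<in>pts M. q x \<in> U}"
  have "istopology ?P"
    unfolding istopology_def
  proof (intro conjI allI impI)
    fix S T assume S: "?P S" and T: "?P T"
    have "{x\<in>pts M. q x \<in> S \<inter> T} = {x\<in>pts M. q x \<in> S} \<inter> {x\<in>pts M. q x \<in> T}" by auto
    then show "openin (mtop M) {x\<in>pts M. q x \<in> S \<inter> T}" using S T by auto
    show "S \<inter> T \<subseteq> q ` pts M" using S by auto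
  next
    fix \<K> assume K: "\<forall>K\<in>\<K>. ?P K"
    have "{x\<in>pts M. q x \<in> \<Union>\<K>} = (\<Union>K\<in>\<K>. {x\<in>pts M. q x \<in> K})" by auto
    moreover have "openin (mtop M) (\<Union>K\<in>\<K>. {x\<in>pts M. q x \<in> K})" using K by blast
    ultimately show "openin (mtop M) {x\<in>pts M. q x \<in> \<Union>\<K>}" by simp
    show "\<Union>\<K> \<subseteq> q ` pts M" using K by blast
  qed
  then have o: "openin (topology ?P) = ?P" by (rule topology_inverse')
  have "{x\<in>pts M. q x \<in> q ` pts M} = pts M" by auto
  then have "?P (q ` pts M)" by simp
  then have "q ` pts M \<subseteq> topspace (topology ?P)" by (intro openin_subset) (simp add: o)
  moreover have "topspace (topology ?P) \<subseteq> q ` pts M"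
    using openin_topspace[of "topology ?P"] unfolding o by blast
  ultimately have "topspace (topology ?P) = q ` pts M" by blast
  then show ?thesis by (simp add: quotient_manifold_def Let_def)
qed

section \<open>Orbits of a Lie groupoid\<close>

context
  fixes G :: "('o, 'g) groupoid"
  assumes G: "lie_groupoid G"
begin

lemma groupoid_smooth:
  "smooth_manifold (Obj G)" "smooth_map (Arr G) (Obj G) (src G)" "smooth_map (Arr G) (Obj G) (tgt G)"
  using G unfolding lie_groupoid_def submersion_def by - (elim conjE, assumption)+

lemma groupoid_pts:
  "g \<in> pts (Arr G) \<Longrightarrow> src G g \<in> pts (Obj G)" "g \<in> pts (Arr G) \<Longrightarrow> tgt G g \<in> pts (Obj G)"
  using smooth_map_pts[OF groupoid_smooth(2)] smooth_map_pts[OF groupoid_smooth(3)] by auto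

lemma groupoid_unit:
  assumes "x \<in> pts (Obj G)"
  shows "unit G x \<in> pts (Arr G)" "src G (unit G x) = x" "tgt G (unit G x) = x"
proof -
  have "smooth_map (Obj G) (Arr G) (unit G)" "\<forall>x\<in>pts (Obj G). src G (unit G x) = x \<and> tgt G (unit G x) = x"
    using G unfolding lie_groupoid_def by - (elim conjE, assumption)+
  then show "unit G x \<in> pts (Arr G)" "src G (unit G x) = x" "tgt G (unit G x) = x"
    using smooth_map_pts assms by auto
qed

lemma groupoid_inv:
  assumes "g \<in> pts (Arr G)"
  shows "ginv G g \<in> pts (Arr G)" "src G (ginv G g) = tgt G g" "tgt G (ginv G g) = src G g"
proof -
  have "smooth_map (Arr G) (Arr G) (ginv G)"
    "\<forall>g\<in>pts (Arr G). src G (ginv G g) = tgt G g \<and> tgt G (ginv G g) = src G g \<and>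
        mult G g (ginv G g) = unit G (tgt G g) \<and> mult G (ginv G g) g = unit G (src G g)"
    using G unfolding lie_groupoid_def by - (elim conjE, assumption)+
  then show "ginv G g \<in> pts (Arr G)" "src G (ginv G g) = tgt G g" "tgt G (ginv G g) = src G g"
    using smooth_map_pts assms by auto
qed

lemma groupoid_mult:
  assumes "g \<in> pts (Arr G)" "h \<in> pts (Arr G)" "src G g = tgt G h"
  shows "mult G g h \<in> pts (Arr G)" "src G (mult G g h) = src G h" "tgt G (mult G g h) = tgt G g"
proof -
  have "smooth_map (fibre_product (Arr G) (Arr G) (src G) (tgt G)) (Arr G) (\<lambda>(g, h). mult G g h)"
    and m: "\<forall>g\<in>pts (Arr G). \<forall>h\<in>pts (Arr G). src G g = tgt G h \<longrightarrow>
        src G (mult G g h) = src G h \<and> tgt G (mult G g h) = tgt G g"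
    using G unfolding lie_groupoid_def by - (elim conjE, assumption)+
  from smooth_map_pts[OF this(1), of "(g, h)"] show "mult G g h \<in> pts (Arr G)"
    using assms by (simp add: pts_fibre_product)
  show "src G (mult G g h) = src G h" "tgt G (mult G g h) = tgt G g" using m assms by auto
qed

lemma equiv_orbit_rel: "equiv (pts (Obj G)) (orbit_rel G)"
proof (rule equivI)
  show "orbit_rel G \<subseteq> pts (Obj G) \<times> pts (Obj G)" using groupoid_pts by (auto simp: orbit_rel_def)
  show "refl_on (pts (Obj G)) (orbit_rel G)"
    using groupoid_unit by (fastforce simp: refl_on_def orbit_rel_def)
  show "sym (orbit_rel G)"
    using groupoid_inv by (fastforce simp: sym_def orbit_rel_def)
  show "trans (orbit_rel G)"
  proof (rule transI)
    fix x y z assume "(x, y) \<in> orbit_rel G" "(y, z) \<in> orbit_rel G"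
    then obtain g h where "g \<in> pts (Arr G)" "src G g = x" "tgt G g = y" "h \<in> pts (Arr G)" "src G h = y" "tgt G h = z"
      by (auto simp: orbit_rel_def)
    then show "(x, z) \<in> orbit_rel G"
      using groupoid_mult[of h g] by (auto simp: orbit_rel_def)
  qed
qed

lemma orbit_proj_arrow:
  assumes "g \<in> pts (Arr G)"
  shows "orbit_proj G (src G g) = orbit_proj G (tgt G g)"
  unfolding orbit_proj_def
  by (rule equiv_class_eq[OF equiv_orbit_rel]) (use assms in \<open>auto simp: orbit_rel_def\<close>)

lemma orbit_proj_eqD:
  assumes "orbit_proj G x = orbit_proj G y" "y \<in> pts (Obj G)"
  obtains g where "g \<in> pts (Arr G)" "src G g = x" "tgt G g = y"
proof -
  have "(x, y) \<in> orbit_rel G"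
    using assms eq_equiv_class[OF _ equiv_orbit_rel] unfolding orbit_proj_def by blast
  then show ?thesis using that by (auto simp: orbit_rel_def)
qed

end

section \<open>Orbit spaces as objects, and uniqueness of the induced map\<close>

lemma points_Psi_obj: "points (Psi_obj G) = pts (Obj G) // orbit_rel G"
  by (simp add: Psi_obj_def orbit_space_def quotient_diffeology_def manifold_diffeology_def)

lemma points_Psi_objE:
  assumes "c \<in> points (Psi_obj G)"
  obtains x where "x \<in> pts (Obj G)" "c = orbit_proj G x"
  using assms unfolding points_Psi_obj orbit_proj_def by (rule quotientE)

lemma orbit_proj_points: "x \<in> pts (Obj G) \<Longrightarrow> orbit_proj G x \<in> points (Psi_obj G)"
  unfolding points_Psi_obj orbit_proj_def by (rule quotientI)

lemma plots_Psi_obj: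
  "(n, U, p) \<in> plots (Psi_obj G) \<longleftrightarrow> openRn n U \<and> p \<in> U \<rightarrow>\<^sub>E points (Psi_obj G) \<and>
    (\<forall>u\<in>U. \<exists>V q. openRn n V \<and> u \<in> V \<and> V \<subseteq> U \<and> q \<in> V \<rightarrow>\<^sub>E pts (Obj G) \<and>
      smooth_map (euclid n V) (Obj G) q \<and> (\<forall>v\<in>V. p v = orbit_proj G (q v)))"
proof -
  have "(n, V, q) \<in> plots (manifold_diffeology (Obj G)) \<longleftrightarrow>
      openRn n V \<and> q \<in> V \<rightarrow>\<^sub>E pts (Obj G) \<and> smooth_map (euclid n V) (Obj G) q" for V q
    by (auto simp: manifold_diffeology_def parametrisations_def)
  then show ?thesis
    unfolding points_Psi_obj orbit_proj_def
    by (simp add: Psi_obj_def orbit_space_def quotient_diffeology_def parametrisations_def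
        manifold_diffeology_def conj_ac cong: conj_cong)
qed

lemma diffeological_space_Psi_obj: "lie_groupoid G \<Longrightarrow> diffeological_space (Psi_obj G)"
  unfolding Psi_obj_def orbit_space_def
  by (intro diffeological_space_quotient diffeological_space_manifold groupoid_smooth)

lemma diffeological_space_plot:
  assumes "diffeological_space X" "(n, U, p) \<in> plots X"
  shows "p \<in> U \<rightarrow>\<^sub>E points X"
  using assms(1)[unfolded diffeological_space_def, THEN conjunct1] assms(2)
  by (auto simp: parametrisations_def)

lemma diffeol_maps_id: "diffeological_space X \<Longrightarrow> diffeol_id X \<in> diffeol_maps X X"
proof -
  assume X: "diffeological_space X"
  have "compose U (\<lambda>x\<in>points X. x) p = p" if "(n, U, p) \<in> plots X" for n U p
  proof -
    have p: "p \<in> U \<rightarrow>\<^sub>E points X"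
      by (rule diffeological_space_plot[OF X that])
    show ?thesis
    proof
      show "compose U (\<lambda>x\<in>points X. x) p u = p u" for u
        using p by (cases "u \<in> U") (auto simp: compose_def PiE_iff extensional_def)
    qed
  qed
  then show ?thesis by (auto simp: diffeol_maps_def diffeol_id_def)
qed

lemma diffeol_maps_comp:
  assumes X: "diffeological_space X" and f: "f \<in> diffeol_maps X Y" and g: "g \<in> diffeol_maps Y Z"
  shows "diffeol_comp X g f \<in> diffeol_maps X Z"
proof -
  have "(n, U, compose U (compose (points X) g f) p) \<in> plots Z" if p: "(n, U, p) \<in> plots X" for n U p
  proof -
    have pU: "p \<in> U \<rightarrow>\<^sub>E points X"
      by (rule diffeological_space_plot[OF X p])
    have "(n, U, compose U g (compose U f p)) \<in> plots Z"
      using f g p unfolding diffeol_maps_def by blast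
    moreover have "compose U g (compose U f p) = compose U (compose (points X) g f) p"
    proof
      show "compose U g (compose U f p) u = compose U (compose (points X) g f) p u" for u
        using pU by (cases "u \<in> U") (auto simp: compose_def PiE_iff)
    qed
    ultimately show ?thesis by simp
  qed
  moreover have "compose (points X) g f \<in> points X \<rightarrow>\<^sub>E points Z"
    using f g by (auto simp: diffeol_maps_def compose_def PiE_iff)
  ultimately show ?thesis by (auto simp: diffeol_maps_def diffeol_comp_def)
qed

text \<open>Surjectivity of the left anchor puts every orbit in the form
  \<open>orbit_proj G (aL P p)\<close>, where both maps are prescribed; off the orbit space both are
  \<open>undefined\<close>.\<close>

lemma Psi_unique:
  assumes onto: "\<And>x. x \<in> pts (Obj G) \<Longrightarrow> \<exists>p\<in>pts (Tot P). aL P p = x"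
    and f: "f \<in> diffeol_maps (Psi_obj G) Y" "\<forall>p\<in>pts (Tot P). f (orbit_proj G (aL P p)) = r p"
    and f': "f' \<in> diffeol_maps (Psi_obj G) Y" "\<forall>p\<in>pts (Tot P). f' (orbit_proj G (aL P p)) = r p"
  shows "f = f'"
proof
  fix c
  show "f c = f' c"
  proof (cases "c \<in> points (Psi_obj G)")
    case True
    then obtain x where "x \<in> pts (Obj G)" "c = orbit_proj G x" by (rule points_Psi_objE)
    then show ?thesis using onto f(2) f'(2) by metis
  next
    case False
    have "f \<in> extensional (points (Psi_obj G))" "f' \<in> extensional (points (Psi_obj G))"
      using f(1) f'(1) by (auto simp: diffeol_maps_def PiE_def)
    then show ?thesis using False by (simp add: extensional_def)
  qed
qed

text \<open>The tool for computing \<open>Psi_arr\<close>: exhibit a smooth map satisfying the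
  equation. Its hypothesis on the bundle is surjectivity of the left anchor, which for
  \<open>bi_id\<close> and \<open>bi_comp\<close> can be read off from their points.\<close>

lemma Psi_arr_eqI:
  assumes "\<And>x. x \<in> pts (Obj G) \<Longrightarrow> \<exists>p\<in>pts (Tot P). aL P p = x"
    and "f \<in> diffeol_maps (Psi_obj G) (Psi_obj H)"
    and "\<forall>p\<in>pts (Tot P). f (orbit_proj G (aL P p)) = orbit_proj H (aR P p)"
  shows "Psi_arr G H P = f"
  unfolding Psi_arr_def
  by (rule the_equality) (use assms Psi_unique[OF assms(1) _ _ assms(2,3)] in blast)+

section \<open>The map of orbit spaces induced by a bibundle\<close>

context
  fixes G :: "('x, 'g) groupoid" and H :: "('y, 'h) groupoid" and P :: "('p, 'x, 'g, 'y, 'h) bibundle"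
  assumes P: "bibundle G H P"
begin

lemma bibundle_smooth:
  "smooth_manifold (Tot P)" "submersion (Tot P) (Obj G) (aL P)" "smooth_map (Tot P) (Obj G) (aL P)"
  "smooth_map (Tot P) (Obj H) (aR P)" "aL P ` pts (Tot P) = pts (Obj G)"
  using P unfolding bibundle_def by - (elim conjE, assumption)+

lemma bibundle_lact:
  assumes "g \<in> pts (Arr G)" "p \<in> pts (Tot P)" "src G g = aL P p"
  shows "lact P g p \<in> pts (Tot P)" "aL P (lact P g p) = tgt G g" "aR P (lact P g p) = aR P p"
proof -
  have "smooth_map (fibre_product (Arr G) (Tot P) (src G) (aL P)) (Tot P) (\<lambda>(g, p). lact P g p)"
    and m: "\<forall>g\<in>pts (Arr G). \<forall>p\<in>pts (Tot P). src G g = aL P p \<longrightarrow>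
        aL P (lact P g p) = tgt G g \<and> aR P (lact P g p) = aR P p"
    using P unfolding bibundle_def by - (elim conjE, assumption)+
  from smooth_map_pts[OF this(1), of "(g, p)"] show "lact P g p \<in> pts (Tot P)"
    using assms by (simp add: pts_fibre_product)
  show "aL P (lact P g p) = tgt G g" "aR P (lact P g p) = aR P p" using m assms by auto
qed

lemma bibundle_ract:
  assumes "p \<in> pts (Tot P)" "h \<in> pts (Arr H)" "aR P p = tgt H h"
  shows "ract P p h \<in> pts (Tot P)" "aL P (ract P p h) = aL P p" "aR P (ract P p h) = src H h"
proof -
  have "smooth_map (fibre_product (Tot P) (Arr H) (aR P) (tgt H)) (Tot P) (\<lambda>(p, h). ract P p h)"
    and m: "\<forall>p\<in>pts (Tot P). \<forall>h\<in>pts (Arr H). aR P p = tgt H h \<longrightarrow>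
        aR P (ract P p h) = src H h \<and> aL P (ract P p h) = aL P p"
    using P unfolding bibundle_def by - (elim conjE, assumption)+
  from smooth_map_pts[OF this(1), of "(p, h)"] show "ract P p h \<in> pts (Tot P)"
    using assms by (simp add: pts_fibre_product)
  show "aL P (ract P p h) = aL P p" "aR P (ract P p h) = src H h" using m assms by auto
qed

text \<open>Surjectivity of the principal action map onto the fibre product of \<open>P\<close> with
  itself.\<close>

lemma bibundle_principal:
  assumes "p \<in> pts (Tot P)" "p' \<in> pts (Tot P)" "aL P p = aL P p'"
  obtains h where "h \<in> pts (Arr H)" "aR P p = tgt H h" "ract P p h = p'"
proof -
  have "diffeomorphism (fibre_product (Tot P) (Arr H) (aR P) (tgt H))
       (fibre_product (Tot P) (Tot P) (aL P) (aL P)) (\<lambda>(p, h). (p, ract P p h))"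
    using P unfolding bibundle_def by - (elim conjE, assumption)+
  then have "(\<lambda>(p, h). (p, ract P p h)) ` pts (fibre_product (Tot P) (Arr H) (aR P) (tgt H)) =
      pts (fibre_product (Tot P) (Tot P) (aL P) (aL P))"
    by (auto simp: diffeomorphism_def bij_betw_def)
  moreover have "(p, p') \<in> pts (fibre_product (Tot P) (Tot P) (aL P) (aL P))"
    using assms by (simp add: pts_fibre_product)
  ultimately have "(p, p') \<in> (\<lambda>(p, h). (p, ract P p h)) ` pts (fibre_product (Tot P) (Arr H) (aR P) (tgt H))"
    by simp
  then show ?thesis using that by (auto simp: pts_fibre_product)
qed

lemma bibundle_onto: "x \<in> pts (Obj G) \<Longrightarrow> \<exists>p\<in>pts (Tot P). aL P p = x"
  using bibundle_smooth(5) by (metis imageE)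

context
  assumes G: "lie_groupoid G" and H: "lie_groupoid H"
begin

text \<open>An arrow \<open>g\<close> joining the two left anchors moves \<open>p\<close> into the
  fibre of \<open>p'\<close> without changing its right anchor. Some \<open>h\<close> then carries
  it to \<open>p'\<close>, and this \<open>h\<close> is an arrow joining the two right
  anchors.\<close>

lemma bibundle_orbit_eq:
  assumes p: "p \<in> pts (Tot P)" "p' \<in> pts (Tot P)" and eq: "orbit_proj G (aL P p) = orbit_proj G (aL P p')"
  shows "orbit_proj H (aR P p) = orbit_proj H (aR P p')"
proof -
  obtain g where g: "g \<in> pts (Arr G)" "src G g = aL P p" "tgt G g = aL P p'"
    using orbit_proj_eqD[OF G eq] smooth_map_pts[OF bibundle_smooth(3) p(2)] by blast
  note l = bibundle_lact[OF g(1) p(1) g(2)]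
  obtain h where h: "h \<in> pts (Arr H)" "aR P (lact P g p) = tgt H h" "ract P (lact P g p) h = p'"
    using bibundle_principal[OF l(1) p(2)] l(2) g(3) by metis
  have "aR P p' = src H h" using bibundle_ract(3)[OF l(1) h(1,2)] h(3) by simp
  moreover have "aR P p = tgt H h" using l(3) h(2) by simp
  ultimately show ?thesis using orbit_proj_arrow[OF H h(1)] by simp
qed

text \<open>A plot of \<open>G\<^sub>0\<close> lifts locally along the submersion \<open>a\<^sub>L\<close>; \<open>r\<close> is the lift followed by \<open>a\<^sub>R\<close>.\<close>

lemma bibundle_plot_lift:
  assumes V: "openRn n V" and q: "smooth_map (euclid n V) (Obj G) q" and u: "u \<in> V"
  obtains V' r where "openRn n V'" "u \<in> V'" "V' \<subseteq> V" "smooth_map (euclid n V') (Obj H) r"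
    "\<And>v. v \<in> V' \<Longrightarrow> \<exists>b\<in>pts (Tot P). aL P b = q v \<and> r v = aR P b"
proof -
  note mG = groupoid_smooth(1)[OF G] and mH = groupoid_smooth(1)[OF H] and mT = bibundle_smooth(1)
  note qc = smooth_map_euclidD[OF mG V q]
  have top: "topspace (subtopology (Euclidean_space n) V) = V" using openRn_subset[OF V] by auto
  then have "q u \<in> pts (Obj G)" using continuous_map_image_subset_topspace[OF qc(1)] u by blast
  \<comment> \<open>Any point of the fibre will do, since the Jacobian of the left anchor is onto
    everywhere.\<close>
  then obtain t where t: "t \<in> pts (Tot P)" "aL P t = q u" using bibundle_onto by blast
  obtain m A \<phi> where A: "(m, A, \<phi>) \<in> atlas (Tot P)" "t \<in> A" by (rule smooth_manifold_covered[OF mT t(1)])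
  obtain k B \<psi> where B: "(k, B, \<psi>) \<in> atlas (Obj G)" "q u \<in> B"
    using smooth_manifold_covered[OF mG \<open>q u \<in> pts (Obj G)\<close>] by metis
  note chA = smooth_manifold_chart[OF mT A(1)] and chB = smooth_manifold_chart[OF mG B(1)]
  let ?F = "local_rep A \<phi> (aL P) \<psi>"
  define U0 where "U0 = \<phi> ` {a\<in>A. aL P a \<in> B}"
  have F_eq: "?F (\<phi> a) = \<psi> (aL P a)" if "a \<in> A" for a
    using that chA(4) by (simp add: local_rep_def inv_into_f_f)
  have U0: "openRn m U0"
  proof -
    have "U0 = {y\<in>\<phi> ` A. aL P (inv_into A \<phi> y) \<in> B}"
      using chA(4) by (auto simp: inv_into_f_f U0_def)
    moreover have "openRn m {y\<in>\<phi> ` A. aL P (inv_into A \<phi> y) \<in> B}"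
      using openRn_preimage_map[OF chA(3) _ chB(1)]
        continuous_map_compose[OF chA(5) smooth_map_continuous[OF bibundle_smooth(3)]] by (simp add: o_def)
    ultimately show ?thesis by simp
  qed
  have F: "smooth_euclid m U0 k ?F"
    using bibundle_smooth(3) A(1) B(1) unfolding smooth_map_def U0_def by blast
  have "jac_onto m k ?F (\<phi> t)"
    using bibundle_smooth(2) A B t(2) unfolding submersion_def jac_onto_def pd_def by fastforce
  moreover have "\<phi> t \<in> U0" using A(2) B(2) t(2) by (auto simp: U0_def)
  ultimately obtain Y s where Y: "openRn k Y" "?F (\<phi> t) \<in> Y" and s: "smooth_euclid k Y m s" "s ` Y \<subseteq> U0"
    "\<And>y. y \<in> Y \<Longrightarrow> ?F (s y) = y"
    using local_section[OF U0 F] by metis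
  define V0 where "V0 = {v\<in>V. q v \<in> B}"
  have V0: "openRn n V0" unfolding V0_def by (rule openRn_preimage_map[OF V qc(1) chB(1)])
  have \<psi>q: "smooth_euclid n V0 k (\<lambda>v. \<psi> (q v))" unfolding V0_def by (rule qc(2)[OF B(1)])
  define V' where "V' = {v\<in>V0. \<psi> (q v) \<in> Y}"
  have V': "openRn n V'" unfolding V'_def by (rule smooth_euclid_preimage[OF V0 \<psi>q Y(1)])
  have c: "smooth_euclid n V' m (\<lambda>v. s (\<psi> (q v)))"
    by (rule smooth_euclid_compose[OF Y(1) V' s(1) smooth_euclid_subset[OF \<psi>q]]) (auto simp: V'_def)
  have cU0: "s (\<psi> (q v)) \<in> U0" if "v \<in> V'" for v using that s(2) by (auto simp: V'_def)
  show ?thesis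
  proof (rule that[OF V'])
    show "u \<in> V'" using u B(2) Y(2) F_eq[OF A(2)] t(2) by (simp add: V'_def V0_def)
    show "V' \<subseteq> V" by (auto simp: V'_def V0_def)
    show "smooth_map (euclid n V') (Obj H) (\<lambda>v. aR P (inv_into A \<phi> (s (\<psi> (q v)))))"
      by (rule smooth_map_chart_param[OF mT mH bibundle_smooth(4) A(1) V' c]) (use cU0 in \<open>auto simp: U0_def\<close>)
    fix v assume v: "v \<in> V'"
    obtain b where b: "b \<in> A" "aL P b \<in> B" "s (\<psi> (q v)) = \<phi> b" using cU0[OF v] by (auto simp: U0_def)
    \<comment> \<open>The section identity holds in the chart \<open>\<psi>\<close>. Both points lie
      in its domain \<open>B\<close>, so injectivity there brings it back to
      \<open>Obj G\<close>.\<close>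
    have "\<psi> (aL P b) = \<psi> (q v)" using s(3)[of "\<psi> (q v)"] F_eq[OF b(1)] b(3) v by (simp add: V'_def)
    then have "aL P b = q v" using chB(4) b(2) v by (auto simp: inj_on_def V'_def V0_def)
    moreover have "inv_into A \<phi> (s (\<psi> (q v))) = b" using b chA(4) by (simp add: inv_into_f_f)
    ultimately show "\<exists>b\<in>pts (Tot P). aL P b = q v \<and> aR P (inv_into A \<phi> (s (\<psi> (q v)))) = aR P b"
      using b(1) chA(2) by blast
  qed
qed

text \<open>The value on an orbit is the orbit of the right anchor of any chosen point of
  \<open>P\<close> above it. For smoothness, a plot is lifted to \<open>Obj G\<close>, then to
  \<open>P\<close>, then pushed to \<open>Obj H\<close>; the outcome is a local lift of the image
  parametrisation.\<close>

lemma Psi_exists: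
  "\<exists>f. f \<in> diffeol_maps (Psi_obj G) (Psi_obj H) \<and>
    (\<forall>p\<in>pts (Tot P). f (orbit_proj G (aL P p)) = orbit_proj H (aR P p))"
proof -
  define f where "f = (\<lambda>c\<in>points (Psi_obj G).
    orbit_proj H (aR P (SOME p. p \<in> pts (Tot P) \<and> orbit_proj G (aL P p) = c)))"
  have f: "f (orbit_proj G (aL P p)) = orbit_proj H (aR P p)" if p: "p \<in> pts (Tot P)" for p
  proof -
    let ?p = "SOME p'. p' \<in> pts (Tot P) \<and> orbit_proj G (aL P p') = orbit_proj G (aL P p)"
    have "?p \<in> pts (Tot P) \<and> orbit_proj G (aL P ?p) = orbit_proj G (aL P p)"
      by (rule someI[of _ p]) (simp add: p)
    then have "orbit_proj H (aR P ?p) = orbit_proj H (aR P p)" using bibundle_orbit_eq p by blast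
    moreover have "orbit_proj G (aL P p) \<in> points (Psi_obj G)"
      by (rule orbit_proj_points[OF smooth_map_pts[OF bibundle_smooth(3) p]])
    ultimately show ?thesis by (simp add: f_def)
  qed
  have aR: "orbit_proj H (aR P p) \<in> points (Psi_obj H)" if "p \<in> pts (Tot P)" for p
    by (rule orbit_proj_points[OF smooth_map_pts[OF bibundle_smooth(4) that]])
  have into: "f \<in> points (Psi_obj G) \<rightarrow>\<^sub>E points (Psi_obj H)"
  proof (rule PiE_I)
    fix c assume "c \<in> points (Psi_obj G)"
    then obtain x where "x \<in> pts (Obj G)" "c = orbit_proj G x" by (rule points_Psi_objE)
    then show "f c \<in> points (Psi_obj H)" using bibundle_onto f aR by metis
  qed (simp add: f_def)
  have "(n, U, compose U f p) \<in> plots (Psi_obj H)" if p: "(n, U, p) \<in> plots (Psi_obj G)" for n U p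
    unfolding plots_Psi_obj
  proof (intro conjI ballI)
    show "openRn n U" using p unfolding plots_Psi_obj by blast
    show "compose U f p \<in> U \<rightarrow>\<^sub>E points (Psi_obj H)"
      using p into unfolding plots_Psi_obj by (auto simp: compose_def PiE_iff)
    fix u assume "u \<in> U"
    obtain V q where "openRn n V \<and> u \<in> V \<and> V \<subseteq> U \<and> q \<in> V \<rightarrow>\<^sub>E pts (Obj G) \<and>
        smooth_map (euclid n V) (Obj G) q \<and> (\<forall>v\<in>V. p v = orbit_proj G (q v))"
      using bspec[OF conjunct2[OF conjunct2[OF iffD1[OF plots_Psi_obj p]]] \<open>u \<in> U\<close>] by (elim exE)
    then have V: "openRn n V" "u \<in> V" "V \<subseteq> U" and q: "smooth_map (euclid n V) (Obj G) q"
      "\<And>v. v \<in> V \<Longrightarrow> p v = orbit_proj G (q v)"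
      by simp_all
    obtain V' r where V': "openRn n V'" "u \<in> V'" "V' \<subseteq> V" and r: "smooth_map (euclid n V') (Obj H) r"
      "\<And>v. v \<in> V' \<Longrightarrow> \<exists>b\<in>pts (Tot P). aL P b = q v \<and> r v = aR P b"
      by (rule bibundle_plot_lift[OF V(1) q(1) V(2)]) (rule that)
    have "openRn n V' \<and> u \<in> V' \<and> V' \<subseteq> U \<and> restrict r V' \<in> V' \<rightarrow>\<^sub>E pts (Obj H) \<and>
        smooth_map (euclid n V') (Obj H) (restrict r V') \<and>
        (\<forall>v\<in>V'. compose U f p v = orbit_proj H (restrict r V' v))"
    proof (intro conjI ballI)
      show "V' \<subseteq> U" using V(3) V'(3) by blast
      show "restrict r V' \<in> V' \<rightarrow>\<^sub>E pts (Obj H)"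
        using r(2) smooth_map_pts[OF bibundle_smooth(4)] by fastforce
      show "smooth_map (euclid n V') (Obj H) (restrict r V')"
        by (rule smooth_map_euclid_cong[OF groupoid_smooth(1)[OF H] V'(1) _ r(1)]) simp
      fix v assume v: "v \<in> V'"
      then obtain b where "b \<in> pts (Tot P)" "aL P b = q v" "r v = aR P b" using r(2) by blast
      then show "compose U f p v = orbit_proj H (restrict r V' v)"
        using f q(2) v V'(3) V(3) by (metis (no_types, lifting) compose_eq restrict_apply' subsetD)
    qed (use V' in auto)
    then show "\<exists>V q. openRn n V \<and> u \<in> V \<and> V \<subseteq> U \<and> q \<in> V \<rightarrow>\<^sub>E pts (Obj H) \<and>
        smooth_map (euclid n V) (Obj H) q \<and> (\<forall>v\<in>V. compose U f p v = orbit_proj H (q v))"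
      by blast
  qed
  then have "f \<in> diffeol_maps (Psi_obj G) (Psi_obj H)" using into by (auto simp: diffeol_maps_def)
  then show ?thesis using f by blast
qed

lemma Psi_arr_props:
  "Psi_arr G H P \<in> diffeol_maps (Psi_obj G) (Psi_obj H)"
  "p \<in> pts (Tot P) \<Longrightarrow> Psi_arr G H P (orbit_proj G (aL P p)) = orbit_proj H (aR P p)"
proof -
  obtain f where f: "f \<in> diffeol_maps (Psi_obj G) (Psi_obj H)"
    "\<forall>p\<in>pts (Tot P). f (orbit_proj G (aL P p)) = orbit_proj H (aR P p)" using Psi_exists by blast
  have "Psi_arr G H P = f" by (rule Psi_arr_eqI[OF bibundle_onto f])
  then show "Psi_arr G H P \<in> diffeol_maps (Psi_obj G) (Psi_obj H)"
    "p \<in> pts (Tot P) \<Longrightarrow> Psi_arr G H P (orbit_proj G (aL P p)) = orbit_proj H (aR P p)"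
    using f by auto
qed

end

end

section \<open>Functoriality and invariance under 2-arrows\<close>

text \<open>The anchors of the identity bibundle are target and source, and the two ends of an arrow
  lie in one orbit.\<close>

lemma Psi_arr_id:
  assumes G: "lie_groupoid G"
  shows "Psi_arr G G (bi_id G) = diffeol_id (Psi_obj G)"
proof (rule Psi_arr_eqI)
  show "\<exists>p\<in>pts (Tot (bi_id G)). aL (bi_id G) p = x" if "x \<in> pts (Obj G)" for x
    using groupoid_unit[OF G that] by (auto simp: bi_id_def)
  show "diffeol_id (Psi_obj G) \<in> diffeol_maps (Psi_obj G) (Psi_obj G)"
    by (rule diffeol_maps_id[OF diffeological_space_Psi_obj[OF G]])
  show "\<forall>p\<in>pts (Tot (bi_id G)). diffeol_id (Psi_obj G) (orbit_proj G (aL (bi_id G) p)) =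
      orbit_proj G (aR (bi_id G) p)"
    using orbit_proj_points[OF groupoid_pts(2)[OF G]] orbit_proj_arrow[OF G]
    by (simp add: bi_id_def diffeol_id_def)
qed

text \<open>On the class of \<open>(p, q)\<close> the anchors are \<open>aL P p\<close> and
  \<open>aR Q q\<close>. The two maps carry the orbit of the first to the orbit of the second
  through that of the middle object \<open>aR P p = aL Q q\<close>.\<close>

lemma Psi_arr_comp:
  assumes G: "lie_groupoid G" and H: "lie_groupoid H" and K: "lie_groupoid K"
    and P: "bibundle G H P" and Q: "bibundle H K Q"
  shows "Psi_arr G K (bi_comp H Q P) = diffeol_comp (Psi_obj G) (Psi_arr H K Q) (Psi_arr G H P)"
proof -
  let ?F = "{(p, q). p \<in> pts (Tot P) \<and> q \<in> pts (Tot Q) \<and> aR P p = aL Q q}"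
  have tot: "pts (Tot (bi_comp H Q P)) = diag_orbit H P Q ` ?F"
    by (simp add: bi_comp_def pts_quotient_manifold pts_fibre_product)
  have anchors: "aL (bi_comp H Q P) (diag_orbit H P Q (p, q)) = aL P p"
    "aR (bi_comp H Q P) (diag_orbit H P Q (p, q)) = aR Q q" if pq: "(p, q) \<in> ?F" for p q
  proof -
    let ?c = "diag_orbit H P Q (p, q)"
    have p: "p \<in> pts (Tot P)" and q: "q \<in> pts (Tot Q)" and e: "aR P p = aL Q q" using pq by auto
    \<comment> \<open>Constancy of the anchors on a diagonal orbit: \<open>aL P\<close> is invariant
      under the right action of \<open>H\<close>, and \<open>aR Q\<close> under its left
      action.\<close>
    have el: "aL P a = aL P p \<and> aR Q b = aR Q q" if "(a, b) \<in> ?c" for a b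
    proof -
      obtain h where h: "h \<in> pts (Arr H)" "tgt H h = aR P p" "a = ract P p h" "b = lact Q (ginv H h) q"
        using \<open>(a, b) \<in> ?c\<close> by (auto simp: diag_orbit_def)
      then show ?thesis
        using bibundle_ract(2)[OF P p h(1)] bibundle_lact(3)[OF Q groupoid_inv(1)[OF H h(1)] q]
          groupoid_inv(2)[OF H h(1)] e by simp
    qed
    \<comment> \<open>\<open>the_elem\<close> of a constant image requires a nonempty orbit; the
      unit at \<open>aR P p\<close> supplies a member.\<close>
    obtain c where c: "c \<in> ?c"
      using groupoid_unit[OF H smooth_map_pts[OF bibundle_smooth(4)[OF P] p]] by (auto simp: diag_orbit_def)
    have "(\<lambda>(p, q). aL P p) ` ?c = (\<lambda>_. aL P p) ` ?c" "(\<lambda>(p, q). aR Q q) ` ?c = (\<lambda>_. aR Q q) ` ?c"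
      using el by (auto intro!: image_cong)
    then show "aL (bi_comp H Q P) ?c = aL P p" "aR (bi_comp H Q P) ?c = aR Q q"
      by (simp_all add: bi_comp_def image_constant[OF c])
  qed
  show ?thesis
  proof (rule Psi_arr_eqI)
    show "\<exists>c\<in>pts (Tot (bi_comp H Q P)). aL (bi_comp H Q P) c = x" if x: "x \<in> pts (Obj G)" for x
    proof -
      obtain p where p: "p \<in> pts (Tot P)" "aL P p = x" using bibundle_onto[OF P x] by blast
      obtain q where q: "q \<in> pts (Tot Q)" "aL Q q = aR P p"
        using bibundle_onto[OF Q smooth_map_pts[OF bibundle_smooth(4)[OF P] p(1)]] by blast
      have "(p, q) \<in> ?F" using p q by simp
      then show ?thesis using anchors(1) p(2) unfolding tot by blast
    qed
    show "diffeol_comp (Psi_obj G) (Psi_arr H K Q) (Psi_arr G H P) \<in> diffeol_maps (Psi_obj G) (Psi_obj K)"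
      by (rule diffeol_maps_comp[OF diffeological_space_Psi_obj[OF G] Psi_arr_props(1)[OF P G H]
            Psi_arr_props(1)[OF Q H K]])
    show "\<forall>c\<in>pts (Tot (bi_comp H Q P)). diffeol_comp (Psi_obj G) (Psi_arr H K Q) (Psi_arr G H P)
        (orbit_proj G (aL (bi_comp H Q P) c)) = orbit_proj K (aR (bi_comp H Q P) c)"
    proof
      fix c assume "c \<in> pts (Tot (bi_comp H Q P))"
      then obtain p q where pq: "(p, q) \<in> ?F" "c = diag_orbit H P Q (p, q)" unfolding tot by blast
      then have p: "p \<in> pts (Tot P)" and q: "q \<in> pts (Tot Q)" and e: "aR P p = aL Q q" by auto
      have "orbit_proj G (aL P p) \<in> points (Psi_obj G)"
        by (rule orbit_proj_points[OF smooth_map_pts[OF bibundle_smooth(3)[OF P] p]])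
      then show "diffeol_comp (Psi_obj G) (Psi_arr H K Q) (Psi_arr G H P)
        (orbit_proj G (aL (bi_comp H Q P) c)) = orbit_proj K (aR (bi_comp H Q P) c)"
        using Psi_arr_props(2)[OF P G H p] Psi_arr_props(2)[OF Q H K q] anchors[OF pq(1)] pq(2) e
        by (simp add: diffeol_comp_def compose_def)
    qed
  qed
qed

text \<open>A 2-arrow preserves both anchors, so the equation for \<open>P'\<close> at
  \<open>\<alpha> p\<close> is the equation for \<open>P\<close> at \<open>p\<close>.\<close>

lemma Psi_arr_iso:
  assumes "lie_groupoid G" "lie_groupoid H" "bibundle G H P" "bibundle G H P'" "bibundle_iso G H P P' \<alpha>"
  shows "Psi_arr G H P = Psi_arr G H P'"
proof (rule Psi_arr_eqI[OF bibundle_onto[OF assms(3)]])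
  show "Psi_arr G H P' \<in> diffeol_maps (Psi_obj G) (Psi_obj H)"
    by (rule Psi_arr_props(1)[OF assms(4,1,2)])
  show "\<forall>p\<in>pts (Tot P). Psi_arr G H P' (orbit_proj G (aL P p)) = orbit_proj H (aR P p)"
  proof
    fix p assume p: "p \<in> pts (Tot P)"
    have \<alpha>: "smooth_map (Tot P) (Tot P') \<alpha>" "aL P' (\<alpha> p) = aL P p" "aR P' (\<alpha> p) = aR P p"
      using assms(5) p by (auto simp: bibundle_iso_def diffeomorphism_def)
    show "Psi_arr G H P' (orbit_proj G (aL P p)) = orbit_proj H (aR P p)"
      using Psi_arr_props(2)[OF assms(4,1,2) smooth_map_pts[OF \<alpha>(1) p]] \<alpha>(2,3) by simp
  qed
qed

theorem theorem3p8:
  shows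
    "(\<forall>G :: ('x, 'g) groupoid. lie_groupoid G \<longrightarrow> diffeological_space (Psi_obj G)) \<and>
     (\<forall>(G :: ('x, 'g) groupoid) (H :: ('y, 'h) groupoid) (P :: ('p, 'x, 'g, 'y, 'h) bibundle).
        lie_groupoid G \<and> lie_groupoid H \<and> bibundle G H P \<longrightarrow>
        (\<exists>!f. f \<in> diffeol_maps (Psi_obj G) (Psi_obj H) \<and>
           (\<forall>p\<in>pts (Tot P). f (orbit_proj G (aL P p)) = orbit_proj H (aR P p))) \<and>
        Psi_arr G H P \<in> diffeol_maps (Psi_obj G) (Psi_obj H) \<and>
        (\<forall>p\<in>pts (Tot P). Psi_arr G H P (orbit_proj G (aL P p)) = orbit_proj H (aR P p))) \<and>
     (\<forall>G :: ('x, 'g) groupoid. lie_groupoid G \<longrightarrow>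
        Psi_arr G G (bi_id G) = diffeol_id (Psi_obj G)) \<and>
     (\<forall>(G :: ('x, 'g) groupoid) (H :: ('y, 'h) groupoid) (K :: ('z, 'k) groupoid)
        (P :: ('p, 'x, 'g, 'y, 'h) bibundle) (Q :: ('q, 'y, 'h, 'z, 'k) bibundle).
        lie_groupoid G \<and> lie_groupoid H \<and> lie_groupoid K \<and> bibundle G H P \<and> bibundle H K Q \<longrightarrow>
        Psi_arr G K (bi_comp H Q P) =
          diffeol_comp (Psi_obj G) (Psi_arr H K Q) (Psi_arr G H P)) \<and>
     (\<forall>(G :: ('x, 'g) groupoid) (H :: ('y, 'h) groupoid)
        (P :: ('p, 'x, 'g, 'y, 'h) bibundle) (P' :: ('q, 'x, 'g, 'y, 'h) bibundle) \<alpha>.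
        lie_groupoid G \<and> lie_groupoid H \<and> bibundle G H P \<and> bibundle G H P' \<and>
        bibundle_iso G H P P' \<alpha> \<longrightarrow>
        Psi_arr G H P = Psi_arr G H P')"
proof (intro conjI allI impI; (elim conjE)?)
  show "diffeological_space (Psi_obj G)" if "lie_groupoid G" for G :: "('x, 'g) groupoid"
    by (rule diffeological_space_Psi_obj[OF that])
next
  fix G :: "('x, 'g) groupoid" and H :: "('y, 'h) groupoid" and P :: "('p, 'x, 'g, 'y, 'h) bibundle"
  assume a: "lie_groupoid G" "lie_groupoid H" "bibundle G H P"
  note props = Psi_arr_props[OF a(3,1,2)]
  show "\<exists>!f. f \<in> diffeol_maps (Psi_obj G) (Psi_obj H) \<and>
      (\<forall>p\<in>pts (Tot P). f (orbit_proj G (aL P p)) = orbit_proj H (aR P p))"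
  proof (rule ex1I)
    show "Psi_arr G H P \<in> diffeol_maps (Psi_obj G) (Psi_obj H) \<and>
        (\<forall>p\<in>pts (Tot P). Psi_arr G H P (orbit_proj G (aL P p)) = orbit_proj H (aR P p))"
      using props by blast
    show "f = Psi_arr G H P" if "f \<in> diffeol_maps (Psi_obj G) (Psi_obj H) \<and>
        (\<forall>p\<in>pts (Tot P). f (orbit_proj G (aL P p)) = orbit_proj H (aR P p))" for f
      using Psi_arr_eqI[OF bibundle_onto[OF a(3)], where f = f] that by simp
  qed
  show "Psi_arr G H P \<in> diffeol_maps (Psi_obj G) (Psi_obj H)" by (rule props(1))
  show "\<forall>p\<in>pts (Tot P). Psi_arr G H P (orbit_proj G (aL P p)) = orbit_proj H (aR P p)"
    using props(2) by blast
next
  show "Psi_arr G G (bi_id G) = diffeol_id (Psi_obj G)" if "lie_groupoid G" for G :: "('x, 'g) groupoid"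
    by (rule Psi_arr_id[OF that])
next
  fix G :: "('x, 'g) groupoid" and H :: "('y, 'h) groupoid" and K :: "('z, 'k) groupoid"
    and P :: "('p, 'x, 'g, 'y, 'h) bibundle" and Q :: "('q, 'y, 'h, 'z, 'k) bibundle"
  assume "lie_groupoid G" "lie_groupoid H" "lie_groupoid K" "bibundle G H P" "bibundle H K Q"
  then show "Psi_arr G K (bi_comp H Q P) = diffeol_comp (Psi_obj G) (Psi_arr H K Q) (Psi_arr G H P)"
    by (rule Psi_arr_comp)
next
  fix G :: "('x, 'g) groupoid" and H :: "('y, 'h) groupoid"
    and P :: "('p, 'x, 'g, 'y, 'h) bibundle" and P' :: "('q, 'x, 'g, 'y, 'h) bibundle" and \<alpha>
  assume "lie_groupoid G" "lie_groupoid H" "bibundle G H P" "bibundle G H P'" "bibundle_iso G H P P' \<alpha>"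
  then show "Psi_arr G H P = Psi_arr G H P'" by (rule Psi_arr_iso)
qed

end
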